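(* Let $W\in\mathcal{C}^\infty(\mathbb{R}^d)$ be real-valued with $W(-x)=W(x)$, let $I\subset\mathbb{R}$ be a compact interval and $N\in\mathbb{N}$. Then $\gamma\in\mathcal{C}^\infty(I,\mathfrak{g}_N^* )$ is a solution to the Liouville equation $$\partial_t\gamma+\sum_{i=1}^Nv_i\cdot\nabla_{x_i}\gamma-\frac{2}{N}\sum_{i=1}^N\sum_{j=1}^N\nabla W(x_i-x_j)\cdot\nabla_{v_i}\gamma=0$$ (in the sense of distributions) if and only if $\dot\gamma=X_{\mathcal{H}_{Lio}}(\gamma)$, where $X_{\mathcal{H}_{Lio}}$ is the unique Hamiltonian vector field generated by $\mathcal{H}_{Lio}$ with respect to the Lie-Poisson space $(\mathfrak{g}_N^*,\{\cdot,\cdot\}_{\mathfrak{g}_N^*})$.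
   Context: Fix $d\in\mathbb{N}$. Points of $\mathbb{R}^{2d}$ are $z=(x,v)$. $\mathfrak{g}_N$ is the real vector space of smooth functions $f:(\mathbb{R}^{2d})^N\to\mathbb{R}$ invariant under permutations of $z_1,\dots,z_N\in\mathbb{R}^{2d}$, with the topology generated by the seminorms $\sup_{|\alpha|\le n}\|\partial^\alpha f\|_{L^\infty(K)}$ ($K$ compact, $n\in\mathbb{N}$). Set $[f,g]_{\mathfrak{g}_N}:=N\sum_{i=1}^N(\nabla_{x_i}f\cdot\nabla_{v_i}g-\nabla_{v_i}f\cdot\nabla_{x_i}g)$. $\mathfrak{g}_N^*$ is the strong dual (permutation-invariant compactly supported distributions on $(\mathbb{R}^{2d})^N$); $\mathfrak{g}_N$ is reflexive, so for $\mathcal{F}\in\mathcal{C}^\infty(\mathfrak{g}_N^* )$ the Gâteaux derivative $\mathrm{d}\mathcal{F}[\gamma]\in\mathfrak{g}_N^{**}$ is identified with an element of $\mathfrak{g}_N$. Smoothness is in the Gâteaux sense: all iterated directional derivatives $\mathrm{d}^n\mathcal{F}:X\times X^n\to Y$ exist and are jointly continuous. $\{\mathcal{F},\mathcal{G}\}_{\mathfrak{g}_N^*}(\gamma):=\langle[\mathrm{d}\mathcal{F}[\gamma],\mathrm{d}\mathcal{G}[\gamma]]_{\mathfrak{g}_N},\gamma\rangle_{\mathfrak{g}_N-\mathfrak{g}_N^*}$. The Hamiltonian vector field of $\mathcal{G}\in\mathcal{C}^\infty(\mathfrak{g}_N^* )$ is the unique smooth $X_{\mathcal{G}}:\mathfrak{g}_N^*\to\mathfrak{g}_N^*$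 with $\mathrm{d}\mathcal{F}[\gamma](X_{\mathcal{G}}(\gamma))=\{\mathcal{F},\mathcal{G}\}_{\mathfrak{g}_N^*}(\gamma)$ for all $\mathcal{F}\in\mathcal{C}^\infty(\mathfrak{g}_N^* )$, $\gamma\in\mathfrak{g}_N^*$. Define $H_N(\underline{z}_N)=\frac12\sum_{i=1}^N|v_i|^2+\frac1N\sum_{1\le i\ne j\le N}W(x_i-x_j)$, $\mathcal{H}_{New}:=\frac1N(H_N+W(0))\in\mathfrak{g}_N$, and $\mathcal{H}_{Lio}(\gamma):=\langle\mathcal{H}_{New},\gamma\rangle_{\mathfrak{g}_N-\mathfrak{g}_N^*}$ for $\gamma\in\mathfrak{g}_N^*$. *)

theory Defs
  imports "HOL-Analysis.Analysis"
begin

section \<open>Smooth functions of finitely many variables\<close>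

primrec Ck :: "nat \<Rightarrow> ('a::real_normed_vector \<Rightarrow> real) \<Rightarrow> bool" where
  "Ck 0 f \<longleftrightarrow> continuous_on UNIV f"
| "Ck (Suc n) f \<longleftrightarrow>
     (\<forall>x. f differentiable at x) \<and> (\<forall>e. Ck n (\<lambda>x. frechet_derivative f (at x) e))"

definition smooth :: "('a::real_normed_vector \<Rightarrow> real) \<Rightarrow> bool" where
  "smooth f \<longleftrightarrow> (\<forall>n. Ck n f)"

text \<open>Iterated partial derivatives; a multi-index of order \<open>m\<close> is a list of \<open>m\<close> basis vectors.\<close>

primrec partials :: "'a list \<Rightarrow> ('a::real_normed_vector \<Rightarrow> real) \<Rightarrow> 'a \<Rightarrow> real" where
  "partials [] f = f"
| "partials (e # es) f = (\<lambda>x. frechet_derivative (partials es f) (at x) e)"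

definition Ck_seminorm :: "'a::euclidean_space set \<Rightarrow> nat \<Rightarrow> ('a \<Rightarrow> real) \<Rightarrow> real" where
  "Ck_seminorm K n f =
     Sup {\<bar>partials es f x\<bar> | es x. set es \<subseteq> Basis \<and> length es \<le> n \<and> x \<in> K}"

definition test_function :: "('a::real_normed_vector \<Rightarrow> real) \<Rightarrow> bool" where
  "test_function \<phi> \<longleftrightarrow> smooth \<phi> \<and> compact (closure {x. \<phi> x \<noteq> 0})"

definition grad :: "(real^'d \<Rightarrow> real) \<Rightarrow> real^'d \<Rightarrow> real^'d" where
  "grad W x = (\<chi> k. frechet_derivative W (at x) (axis k 1))"

lemma Ck_continuous: "Ck n f \<Longrightarrow> continuous_on UNIV f"
  by (cases n) (auto simp: continuous_at_imp_continuous_on differentiable_imp_continuous_within)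

lemma Ck_SucD: "Ck (Suc n) f \<Longrightarrow> Ck n f"
proof (induction n arbitrary: f)
  case 0
  show ?case unfolding Ck.simps(1) by (rule Ck_continuous[OF 0])
next
  case (Suc n)
  from Suc.prems have "\<forall>x. f differentiable at x"
      "\<forall>e. Ck (Suc n) (\<lambda>x. frechet_derivative f (at x) e)"
    unfolding Ck.simps(2)[of "Suc n"] by blast+
  with Suc.IH show ?case unfolding Ck.simps(2)[of n] by blast
qed

lemma Ck_const [simp]: "Ck n (\<lambda>x. c)"
  by (induction n arbitrary: c) simp_all

lemma Ck_add: "Ck n f \<Longrightarrow> Ck n g \<Longrightarrow> Ck n (\<lambda>x. f x + g x)"
proof (induction n arbitrary: f g)
  case (Suc n)
  then have d: "f differentiable at x" "g differentiable at x" for x by simp_all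
  have "frechet_derivative (\<lambda>x. f x + g x) (at x) =
      (\<lambda>e. frechet_derivative f (at x) e + frechet_derivative g (at x) e)" for x
    using d[of x, unfolded frechet_derivative_works]
    by (intro frechet_derivative_at[symmetric] has_derivative_add) auto
  with Suc d show ?case by simp
qed (simp add: continuous_on_add)

lemma Ck_mult: "Ck n f \<Longrightarrow> Ck n g \<Longrightarrow> Ck n (\<lambda>x. f x * g x)"
proof (induction n arbitrary: f g)
  case (Suc n)
  then have d: "f differentiable at x" "g differentiable at x" for x by simp_all
  have "frechet_derivative (\<lambda>x. f x * g x) (at x) =
      (\<lambda>e. f x * frechet_derivative g (at x) e + frechet_derivative f (at x) e * g x)" for x
    using d[of x, unfolded frechet_derivative_works]
    by (intro frechet_derivative_at[symmetric] has_derivative_mult) auto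
  moreover have "Ck n (\<lambda>x. f x * frechet_derivative g (at x) e + frechet_derivative f (at x) e * g x)" for e
    using Suc.prems Ck_SucD[OF Suc.prems(1)] Ck_SucD[OF Suc.prems(2)]
    by (intro Ck_add Suc.IH) simp_all
  ultimately show ?case using d by simp
qed (simp add: continuous_on_mult)

lemma Ck_compose_linear:
  assumes L: "bounded_linear L"
  shows "Ck n f \<Longrightarrow> Ck n (\<lambda>x. f (L x))"
proof (induction n arbitrary: f)
  case 0
  then show ?case
    using continuous_on_compose2[of UNIV f UNIV L] L by (simp add: linear_continuous_on)
next
  case (Suc n)
  have "((\<lambda>x. f (L x)) has_derivative (\<lambda>e. frechet_derivative f (at (L x)) (L e))) (at x)" for x
    using Suc.prems bounded_linear_imp_has_derivative[OF L, of "at x"]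
    by (intro has_derivative_compose[where g = f and f = L, simplified])
       (auto simp: frechet_derivative_works)
  then have *: "(\<lambda>x. f (L x)) differentiable at x"
      "frechet_derivative (\<lambda>x. f (L x)) (at x) = (\<lambda>e. frechet_derivative f (at (L x)) (L e))" for x
    by (auto simp: differentiable_def frechet_derivative_at[symmetric])
  have "Ck n (\<lambda>x. frechet_derivative f (at (L x)) (L e))" for e
    using Suc.prems by (intro Suc.IH) simp
  then show ?case by (simp add: *)
qed

lemma Ck_linear: "bounded_linear (L :: _ \<Rightarrow> real) \<Longrightarrow> Ck n L"
proof (cases n)
  case (Suc m)
  assume L: "bounded_linear L"
  have "(L has_derivative L) (at x)" for x by (rule bounded_linear_imp_has_derivative[OF L])
  then have "L differentiable at x" "frechet_derivative L (at x) = L" for x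
    by (auto simp: differentiable_def frechet_derivative_at[symmetric])
  then show ?thesis by (simp add: Suc)
qed (simp add: linear_continuous_on)

lemma smooth_const [simp]: "smooth (\<lambda>x. c)"
  and smooth_add: "smooth f \<Longrightarrow> smooth g \<Longrightarrow> smooth (\<lambda>x. f x + g x)"
  and smooth_mult: "smooth f \<Longrightarrow> smooth g \<Longrightarrow> smooth (\<lambda>x. f x * g x)"
  and smooth_compose_linear: "smooth h \<Longrightarrow> bounded_linear L \<Longrightarrow> smooth (\<lambda>x. h (L x))"
  and smooth_linear: "bounded_linear f \<Longrightarrow> smooth f"
  by (simp_all add: smooth_def Ck_add Ck_mult Ck_compose_linear Ck_linear)

lemma smooth_frechet: "smooth f \<Longrightarrow> smooth (\<lambda>x. frechet_derivative f (at x) e)"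
  unfolding smooth_def by (metis Ck.simps(2))

lemma smooth_cmult: "smooth f \<Longrightarrow> smooth (\<lambda>x. c * f x)"
  by (rule smooth_mult) simp_all

lemma smooth_diff: "smooth f \<Longrightarrow> smooth g \<Longrightarrow> smooth (\<lambda>x. f x - g x)"
  using smooth_add[of f "\<lambda>x. (- 1) * g x"] smooth_cmult[of g "- 1"] by simp

lemma smooth_sum: "(\<And>i. i \<in> A \<Longrightarrow> smooth (f i)) \<Longrightarrow> smooth (\<lambda>x. \<Sum>i\<in>A. f i x)"
  by (induction A rule: infinite_finite_induct) (simp_all add: smooth_add)

lemma smooth_differentiable: "smooth f \<Longrightarrow> f differentiable at x"
  unfolding smooth_def by (metis Ck.simps(2))


section \<open>The strong dual of a topological vector space\<close>

definition tvs_bounded :: "'a::{real_vector,topological_space} set \<Rightarrow> bool" where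
  "tvs_bounded B \<longleftrightarrow>
     (\<forall>U. open U \<and> 0 \<in> U \<longrightarrow> (\<exists>r>0. \<forall>s\<ge>r. B \<subseteq> (\<lambda>x. s *\<^sub>R x) ` U))"

typedef (overloaded) 'a strong_dual =
  "{\<phi> :: 'a::{real_vector,topological_space} \<Rightarrow> real. linear \<phi> \<and> continuous_on UNIV \<phi>}"
  morphisms pairing Abs_strong_dual
  by (rule exI[of _ "\<lambda>x. 0"]) (simp add: linear_zero)

setup_lifting type_definition_strong_dual

instantiation strong_dual :: ("{real_vector,topological_space}") real_vector
begin

lift_definition zero_strong_dual :: "'a strong_dual" is "\<lambda>x. 0"
  by (simp add: linear_zero)
lift_definition plus_strong_dual :: "'a strong_dual \<Rightarrow> 'a strong_dual \<Rightarrow> 'a strong_dual"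
  is "\<lambda>\<phi> \<psi> x. \<phi> x + \<psi> x"
  by (simp add: linear_compose_add continuous_on_add)
lift_definition minus_strong_dual :: "'a strong_dual \<Rightarrow> 'a strong_dual \<Rightarrow> 'a strong_dual"
  is "\<lambda>\<phi> \<psi> x. \<phi> x - \<psi> x"
  by (simp add: linear_compose_sub continuous_on_diff)
lift_definition uminus_strong_dual :: "'a strong_dual \<Rightarrow> 'a strong_dual" is "\<lambda>\<phi> x. - \<phi> x"
  by (simp add: linear_compose_neg continuous_on_minus)
lift_definition scaleR_strong_dual :: "real \<Rightarrow> 'a strong_dual \<Rightarrow> 'a strong_dual"
  is "\<lambda>c \<phi> x. c * \<phi> x"
  using linear_compose_scale_right[where 'b = real] by (auto intro: continuous_on_mult_left)

instance
  by standard (transfer; simp add: algebra_simps fun_eq_iff)+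

end

instantiation strong_dual :: ("{real_vector,topological_space}") topological_space
begin

definition open_strong_dual :: "'a strong_dual set \<Rightarrow> bool" where
  "open_strong_dual = generate_topology
     {{\<psi>. (SUP x\<in>B. \<bar>pairing \<psi> x - pairing \<phi> x\<bar>) < \<epsilon>} | \<phi> B \<epsilon>.
        tvs_bounded B \<and> B \<noteq> {} \<and> 0 < \<epsilon>}"

instance
  by standard
    (auto simp: open_strong_dual_def intro: generate_topology.UNIV generate_topology.Int generate_topology.UN)

end


section \<open>Smoothness in the Gateaux sense\<close>

text \<open>
  For \<open>S = UNIV\<close> this is the usual calculus on locally convex spaces. If \<open>S\<close> is a compact interval
  of positive length in \<open>real\<close>, the limits are one-sided at the end points.
\<close>

definition has_gateaux ::
  "'x::{real_vector,topological_space} set \<Rightarrow> ('x \<Rightarrow> 'y::{real_vector,topological_space}) \<Rightarrow> 'x \<Rightarrow> 'x \<Rightarrow> 'y \<Rightarrow> bool" where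
  "has_gateaux S F x v y \<longleftrightarrow>
     ((\<lambda>t::real. (1 / t) *\<^sub>R (F (x + t *\<^sub>R v) - F x)) \<longlongrightarrow> y) (at 0 within {t. x + t *\<^sub>R v \<in> S})"

definition gateaux ::
  "'x::{real_vector,topological_space} set \<Rightarrow> ('x \<Rightarrow> 'y::{real_vector,topological_space}) \<Rightarrow> 'x \<Rightarrow> 'x \<Rightarrow> 'y" where
  "gateaux S F x v = (THE y. has_gateaux S F x v y)"

primrec iter_gateaux ::
  "'x::{real_vector,topological_space} set \<Rightarrow> ('x \<Rightarrow> 'y::{real_vector,topological_space}) \<Rightarrow> nat \<Rightarrow> 'x \<Rightarrow> (nat \<Rightarrow> 'x) \<Rightarrow> 'y" where
  "iter_gateaux S F 0 x vs = F x"
| "iter_gateaux S F (Suc n) x vs = gateaux S (\<lambda>y. iter_gateaux S F n y vs) x (vs n)"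

text \<open>\<open>iter_gateaux S F n x vs\<close> depends only on \<open>x\<close> and \<open>vs 0, \<dots>, vs (n - 1)\<close>, i.e. it is a
  function on \<open>S \<times> X\<^sup>n\<close>.\<close>

definition gateaux_smooth ::
  "'x::{real_vector,topological_space} set \<Rightarrow> ('x \<Rightarrow> 'y::{real_vector,topological_space}) \<Rightarrow> bool" where
  "gateaux_smooth S F \<longleftrightarrow>
     (\<forall>n. (\<forall>x\<in>S. \<forall>vs. \<exists>y. has_gateaux S (\<lambda>x. iter_gateaux S F n x vs) x (vs n) y) \<and>
          continuous_map
            (prod_topology (top_of_set S) (product_topology (\<lambda>_. euclidean) {..<n})) euclidean
            (\<lambda>(x, vs). iter_gateaux S F n x vs))"

section \<open>The Lie algebra of symmetric smooth functions\<close>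

text \<open>
  A configuration \<open>z\<close> assigns to each of the \<open>CARD('n)\<close> particles \<open>i\<close> a pair \<open>z $ i = (x\<^sub>i, v\<^sub>i)\<close>.
\<close>

type_synonym ('d, 'n) config = "((real^'d) \<times> (real^'d))^'n"

definition permute :: "('n \<Rightarrow> 'n) \<Rightarrow> ('d::finite, 'n::finite) config \<Rightarrow> ('d, 'n) config" where
  "permute p z = (\<chi> i. z $ p i)"

definition symmetric :: "(('d::finite, 'n::finite) config \<Rightarrow> real) \<Rightarrow> bool" where
  "symmetric f \<longleftrightarrow> (\<forall>p. bij p \<longrightarrow> (\<forall>z. f (permute p z) = f z))"

typedef ('d, 'n) symfun =
  "{f :: ('d::finite, 'n::finite) config \<Rightarrow> real. smooth f \<and> symmetric f}"
  morphisms apply_symfun Abs_symfun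
  by (rule exI[of _ "\<lambda>z. 0"]) (simp add: symmetric_def)

setup_lifting type_definition_symfun

instantiation symfun :: (finite, finite) real_vector
begin

lift_definition zero_symfun :: "('a, 'b) symfun" is "\<lambda>z. 0"
  by (simp add: symmetric_def)
lift_definition plus_symfun :: "('a, 'b) symfun \<Rightarrow> ('a, 'b) symfun \<Rightarrow> ('a, 'b) symfun"
  is "\<lambda>f g z. f z + g z"
  by (simp add: symmetric_def smooth_add)
lift_definition minus_symfun :: "('a, 'b) symfun \<Rightarrow> ('a, 'b) symfun \<Rightarrow> ('a, 'b) symfun"
  is "\<lambda>f g z. f z - g z"
  by (simp add: symmetric_def smooth_diff)
lift_definition uminus_symfun :: "('a, 'b) symfun \<Rightarrow> ('a, 'b) symfun" is "\<lambda>f z. - f z"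
  using smooth_cmult[where c = "- 1"] by (auto simp: symmetric_def)
lift_definition scaleR_symfun :: "real \<Rightarrow> ('a, 'b) symfun \<Rightarrow> ('a, 'b) symfun" is "\<lambda>c f z. c * f z"
  by (simp add: symmetric_def smooth_cmult)

instance
  by standard (transfer; simp add: algebra_simps fun_eq_iff)+

end

instantiation symfun :: (finite, finite) topological_space
begin

definition open_symfun :: "('a, 'b) symfun set \<Rightarrow> bool" where
  "open_symfun = generate_topology
     {{g. Ck_seminorm K n (apply_symfun (g - f)) < \<epsilon>} | f K n \<epsilon>. compact K \<and> K \<noteq> {} \<and> 0 < \<epsilon>}"

instance
  by standard
    (auto simp: open_symfun_def intro: generate_topology.UNIV generate_topology.Int generate_topology.UN)

end

definition basis_x :: "'n \<Rightarrow> 'd \<Rightarrow> ('d::finite, 'n::finite) config" where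
  "basis_x i k = axis i (axis k 1, 0)"

definition basis_v :: "'n \<Rightarrow> 'd \<Rightarrow> ('d::finite, 'n::finite) config" where
  "basis_v i k = axis i (0, axis k 1)"

definition grad_x :: "'n \<Rightarrow> (('d::finite, 'n::finite) config \<Rightarrow> real) \<Rightarrow> ('d, 'n) config \<Rightarrow> real^'d" where
  "grad_x i f z = (\<chi> k. frechet_derivative f (at z) (basis_x i k))"

definition grad_v :: "'n \<Rightarrow> (('d::finite, 'n::finite) config \<Rightarrow> real) \<Rightarrow> ('d, 'n) config \<Rightarrow> real^'d" where
  "grad_v i f z = (\<chi> k. frechet_derivative f (at z) (basis_v i k))"

lemma bounded_linear_permute: "bounded_linear (permute p :: ('d::finite, 'n::finite) config \<Rightarrow> _)"
  by (auto intro!: linearI simp: linear_conv_bounded_linear[symmetric] permute_def vec_eq_iff)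

lemma permute_axis: "bij p \<Longrightarrow> permute p (axis (p i) u) = axis i u"
  by (auto simp: permute_def axis_def vec_eq_iff bij_def inj_eq)

lemma symmetric_frechet:
  assumes "smooth f" "symmetric f" "bij p"
  shows "frechet_derivative f (at (permute p z)) (permute p e) = frechet_derivative f (at z) e"
proof -
  have "((\<lambda>z. f (permute p z)) has_derivative
      (\<lambda>e. frechet_derivative f (at (permute p z)) (permute p e))) (at z)"
    using smooth_differentiable[OF assms(1)]
      bounded_linear_imp_has_derivative[OF bounded_linear_permute, of p "at z"]
    by (intro has_derivative_compose[where g = f and f = "permute p", simplified])
       (auto simp: frechet_derivative_works)
  moreover have "(\<lambda>z. f (permute p z)) = f"
    using assms by (auto simp: symmetric_def)
  ultimately show ?thesis by (simp add: frechet_derivative_at[symmetric])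
qed

lemma grad_permute:
  assumes "smooth f" "symmetric f" "bij p"
  shows "grad_x i f (permute p z) = grad_x (p i) f z" "grad_v i f (permute p z) = grad_v (p i) f z"
  unfolding grad_x_def grad_v_def basis_x_def basis_v_def
  by (simp_all add: symmetric_frechet[OF assms, of z "axis (p i) _", unfolded permute_axis[OF assms(3)]])

lemma smooth_inner_grads:
  assumes "smooth f" "smooth g"
  shows "smooth (\<lambda>z. grad_x i f z \<bullet> grad_v i g z)" "smooth (\<lambda>z. grad_v i f z \<bullet> grad_x i g z)"
  unfolding grad_x_def grad_v_def inner_vec_def inner_real_def vec_lambda_beta
  by (intro smooth_sum smooth_mult smooth_frechet assms)+

lift_definition lie_bracket :: "('d::finite, 'n::finite) symfun \<Rightarrow> ('d, 'n) symfun \<Rightarrow> ('d, 'n) symfun"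
  is "\<lambda>f g z. real CARD('n) *
        (\<Sum>i\<in>UNIV. grad_x i f z \<bullet> grad_v i g z - grad_v i f z \<bullet> grad_x i g z)"
proof safe
  fix f g :: "('d, 'n) config \<Rightarrow> real"
  assume *: "smooth f" "symmetric f" "smooth g" "symmetric g"
  then show "smooth (\<lambda>z. real CARD('n) *
      (\<Sum>i\<in>UNIV. grad_x i f z \<bullet> grad_v i g z - grad_v i f z \<bullet> grad_x i g z))"
    by (intro smooth_cmult smooth_sum smooth_diff smooth_inner_grads)
  let ?S = "\<lambda>z i. grad_x i f z \<bullet> grad_v i g z - grad_v i f z \<bullet> grad_x i g z"
  have "(\<Sum>i\<in>UNIV. ?S z (p i)) = (\<Sum>i\<in>UNIV. ?S z i)" if "bij p" for p z
    using that by (rule sum.reindex_bij_betw)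
  then have "(\<Sum>i\<in>UNIV. ?S (permute p z) i) = (\<Sum>i\<in>UNIV. ?S z i)" if "bij p" for p z
    unfolding grad_permute[OF *(1,2) that] grad_permute[OF *(3,4) that] using that by blast
  then show "symmetric (\<lambda>z. real CARD('n) *
      (\<Sum>i\<in>UNIV. grad_x i f z \<bullet> grad_v i g z - grad_v i f z \<bullet> grad_x i g z))"
    unfolding symmetric_def[where f = "\<lambda>z. _ * _ z"] by (intro allI impI arg_cong[where f = "(*) _"])
qed


section \<open>The Lie-Poisson structure on the dual\<close>

text \<open>
  The derivative of a smooth functional at a point is an element of the bidual of
  \<^typ>\<open>('d, 'n) symfun\<close>; by reflexivity it is evaluation at a unique element of \<^typ>\<open>('d, 'n) symfun\<close>.
\<close>

definition functional_deriv ::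
  "(('d::finite, 'n::finite) symfun strong_dual \<Rightarrow> real) \<Rightarrow> ('d, 'n) symfun strong_dual \<Rightarrow> ('d, 'n) symfun" where
  "functional_deriv F \<gamma> = (THE f. \<forall>\<eta>. pairing \<eta> f = gateaux UNIV F \<gamma> \<eta>)"

definition poisson_bracket ::
  "(('d::finite, 'n::finite) symfun strong_dual \<Rightarrow> real) \<Rightarrow> (('d, 'n) symfun strong_dual \<Rightarrow> real)
     \<Rightarrow> ('d, 'n) symfun strong_dual \<Rightarrow> real" where
  "poisson_bracket F G \<gamma> = pairing \<gamma> (lie_bracket (functional_deriv F \<gamma>) (functional_deriv G \<gamma>))"

definition is_hamiltonian_vf ::
  "(('d::finite, 'n::finite) symfun strong_dual \<Rightarrow> real)
     \<Rightarrow> (('d, 'n) symfun strong_dual \<Rightarrow> ('d, 'n) symfun strong_dual) \<Rightarrow> bool" where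
  "is_hamiltonian_vf G X \<longleftrightarrow>
     gateaux_smooth UNIV G \<and> gateaux_smooth UNIV X \<and>
     (\<forall>F. gateaux_smooth UNIV F \<longrightarrow> (\<forall>\<gamma>. gateaux UNIV F \<gamma> (X \<gamma>) = poisson_bracket F G \<gamma>))"

definition hamiltonian_vf ::
  "(('d::finite, 'n::finite) symfun strong_dual \<Rightarrow> real)
     \<Rightarrow> ('d, 'n) symfun strong_dual \<Rightarrow> ('d, 'n) symfun strong_dual" where
  "hamiltonian_vf G = (THE X. is_hamiltonian_vf G X)"


section \<open>Newton and Liouville Hamiltonians\<close>

definition H_N :: "(real^'d \<Rightarrow> real) \<Rightarrow> ('d::finite, 'n::finite) config \<Rightarrow> real" where
  "H_N W z = (1 / 2) * (\<Sum>i\<in>UNIV. (norm (snd (z $ i)))\<^sup>2)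
     + (1 / real CARD('n)) * (\<Sum>(i, j)\<in>{(i, j). i \<noteq> j}. W (fst (z $ i) - fst (z $ j)))"

text \<open>The argument of \<^const>\<open>Abs_symfun\<close> is smooth and symmetric whenever \<open>W\<close> is smooth; see
  \<open>apply_H_New\<close> below.\<close>

definition H_New :: "(real^'d \<Rightarrow> real) \<Rightarrow> ('d::finite, 'n::finite) symfun" where
  "H_New W = Abs_symfun (\<lambda>z. (1 / real CARD('n)) * (H_N W z + W 0))"

definition H_Lio :: "(real^'d \<Rightarrow> real) \<Rightarrow> ('d::finite, 'n::finite) symfun strong_dual \<Rightarrow> real" where
  "H_Lio W \<gamma> = pairing \<gamma> (H_New W)"

lemma smooth_H_N:
  assumes "smooth W"
  shows "smooth (H_N W :: ('d::finite, 'n::finite) config \<Rightarrow> real)"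
proof -
  have "bounded_linear (\<lambda>z :: ('d, 'n) config. fst (z $ i) - fst (z $ j))" for i j
    by (intro bounded_linear_sub bounded_linear_fst_comp bounded_linear_vec_nth)
  moreover have "bounded_linear (\<lambda>z :: ('d, 'n) config. snd (z $ i) $ k)" for i k
    using bounded_linear_compose[OF bounded_linear_vec_nth
        bounded_linear_compose[OF bounded_linear_snd bounded_linear_vec_nth]] by auto
  ultimately show ?thesis
    unfolding H_N_def[abs_def] power2_norm_eq_inner inner_vec_def case_prod_unfold inner_real_def
    by (intro smooth_add smooth_cmult smooth_sum smooth_mult smooth_compose_linear[OF assms])
       (auto intro: smooth_linear)
qed

lemma symmetric_H_N: "symmetric (H_N W :: ('d::finite, 'n::finite) config \<Rightarrow> real)"
  unfolding symmetric_def
proof (intro allI impI)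
  fix p :: "'n \<Rightarrow> 'n" and z :: "('d, 'n) config"
  assume p: "bij p"
  have "(\<Sum>i\<in>UNIV. (norm (snd (z $ p i)))\<^sup>2) = (\<Sum>i\<in>UNIV. (norm (snd (z $ i)))\<^sup>2)"
    using p by (rule sum.reindex_bij_betw)
  moreover have "(\<Sum>x\<in>{x. fst x \<noteq> snd x}. W (fst (z $ p (fst x)) - fst (z $ p (snd x))))
      = (\<Sum>x\<in>{x. fst x \<noteq> snd x}. W (fst (z $ fst x) - fst (z $ snd x)))"
    using p
    by (intro sum.reindex_bij_witness[where i = "map_prod (inv p) (inv p)" and j = "map_prod p p"])
       (auto simp: bij_is_inj bij_is_surj surj_f_inv_f inj_eq dest: bij_is_inj bij_imp_bij_inv)
  ultimately show "H_N W (permute p z) = H_N W z"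
    by (simp add: H_N_def permute_def case_prod_unfold)
qed

lemma apply_H_New:
  assumes "smooth W"
  shows "apply_symfun (H_New W :: ('d::finite, 'n::finite) symfun)
     = (\<lambda>z. (1 / real CARD('n)) * (H_N W z + W 0))"
  unfolding H_New_def
proof (rule Abs_symfun_inverse, rule CollectI, rule conjI)
  show "smooth (\<lambda>z :: ('d, 'n) config. (1 / real CARD('n)) * (H_N W z + W 0))"
    by (rule smooth_cmult[OF smooth_add[OF smooth_H_N[OF assms] smooth_const]])
  show "symmetric (\<lambda>z :: ('d, 'n) config. (1 / real CARD('n)) * (H_N W z + W 0))"
    using symmetric_H_N[of W, where ?'n = 'n] by (simp add: symmetric_def)
qed


section \<open>The Liouville equation in the sense of distributions\<close>

text \<open>
  A functional on \<^typ>\<open>('d, 'n) symfun\<close> is a permutation invariant distribution on configuration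
  space: it acts on a function without symmetry by acting on its symmetrization.
\<close>

definition symmetrize :: "(('d::finite, 'n::finite) config \<Rightarrow> real) \<Rightarrow> ('d, 'n) symfun" where
  "symmetrize \<phi> = Abs_symfun (\<lambda>z. (1 / fact CARD('n)) * (\<Sum>p\<in>{p. bij p}. \<phi> (permute p z)))"

lemma apply_symmetrize:
  fixes \<phi> :: "('d::finite, 'n::finite) config \<Rightarrow> real"
  assumes "smooth \<phi>"
  shows "apply_symfun (symmetrize \<phi>) = (\<lambda>z. (1 / fact CARD('n)) * (\<Sum>p\<in>{p. bij p}. \<phi> (permute p z)))"
  unfolding symmetrize_def
proof (intro Abs_symfun_inverse CollectI conjI)
  show "smooth (\<lambda>z. (1 / fact CARD('n)) * (\<Sum>p\<in>{p. bij p}. \<phi> (permute p z)))"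
    by (intro smooth_cmult smooth_sum smooth_compose_linear[OF assms] bounded_linear_permute)
  show "symmetric (\<lambda>z. (1 / fact CARD('n)) * (\<Sum>p\<in>{p. bij p}. \<phi> (permute p z)))"
    unfolding symmetric_def
  proof (intro allI impI)
    fix q :: "'n \<Rightarrow> 'n" and z :: "('d, 'n) config"
    assume q: "bij q"
    have "bij_betw (\<lambda>p. q \<circ> p) {p. bij p} {p. bij p}"
      using q by (intro bij_betwI[where g = "\<lambda>p. inv q \<circ> p"])
        (auto simp: bij_comp bij_imp_bij_inv fun_eq_iff bij_is_inj bij_is_surj surj_f_inv_f)
    then have "(\<Sum>p\<in>{p. bij p}. \<phi> (permute (q \<circ> p) z)) = (\<Sum>p\<in>{p. bij p}. \<phi> (permute p z))"
      by (rule sum.reindex_bij_betw)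
    then show "(1 / fact CARD('n)) * (\<Sum>p\<in>{p. bij p}. \<phi> (permute p (permute q z)))
        = (1 / fact CARD('n)) * (\<Sum>p\<in>{p. bij p}. \<phi> (permute p z))"
      by (simp add: permute_def o_def)
  qed
qed

type_synonym 'a distribution = "('a \<Rightarrow> real) \<Rightarrow> real"

definition distribution_of ::
  "('d::finite, 'n::finite) symfun strong_dual \<Rightarrow> ('d, 'n) config distribution" where
  "distribution_of \<gamma> \<phi> = pairing \<gamma> (symmetrize \<phi>)"

definition dist_partial :: "'a::real_normed_vector \<Rightarrow> 'a distribution \<Rightarrow> 'a distribution" where
  "dist_partial e T \<phi> = - T (\<lambda>x. frechet_derivative \<phi> (at x) e)"

definition dist_mult :: "('a \<Rightarrow> real) \<Rightarrow> 'a distribution \<Rightarrow> 'a distribution" where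
  "dist_mult a T \<phi> = T (\<lambda>x. a x * \<phi> x)"

definition curve_deriv :: "real set \<Rightarrow> (real \<Rightarrow> 'y::{real_vector,topological_space}) \<Rightarrow> real \<Rightarrow> 'y" where
  "curve_deriv I \<gamma> t = gateaux I \<gamma> t 1"

definition liouville_solution ::
  "(real^'d \<Rightarrow> real) \<Rightarrow> real set \<Rightarrow> (real \<Rightarrow> ('d::finite, 'n::finite) symfun strong_dual) \<Rightarrow> bool" where
  "liouville_solution W I \<gamma> \<longleftrightarrow>
     (\<forall>t\<in>I. \<forall>\<phi>. test_function \<phi> \<longrightarrow>
        distribution_of (curve_deriv I \<gamma> t) \<phi>
        + (\<Sum>i\<in>UNIV. \<Sum>k\<in>UNIV.
             dist_mult (\<lambda>z. snd (z $ i) $ k) (dist_partial (basis_x i k) (distribution_of (\<gamma> t))) \<phi>)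
        - (2 / real CARD('n)) * (\<Sum>i\<in>UNIV. \<Sum>j\<in>UNIV. \<Sum>k\<in>UNIV.
             dist_mult (\<lambda>z. grad W (fst (z $ i) - fst (z $ j)) $ k)
               (dist_partial (basis_v i k) (distribution_of (\<gamma> t))) \<phi>) = 0)"

end

theory Submission
  imports Defs
begin

text \<open>
  A continuous linear functional on the strong dual of the symmetric functions is evaluation at
  a symmetric function (reflexivity), and the Gateaux derivative of a smooth functional is such a functional.
  Hence the bracket \<open>{F, H}\<close> with the linear functional \<open>H = \<langle>h, _\<rangle>\<close> is the derivative of \<open>F\<close> along the
  transpose of \<open>f \<mapsto> [f, h]\<close>, which is continuous by the Leibniz rule; testing with linear \<open>F\<close>
  shows that no other vector field has this property. For \<open>h\<close> the Newton
  Hamiltonian, evenness of \<open>W\<close> turns \<open>[f, h]\<close> into the Liouville transport operator applied to \<open>f\<close>,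
  which commutes with symmetrization. So the Liouville equation says that both sides of the
  Hamiltonian equation agree on symmetrized test functions, and these are dense.
\<close>

section \<open>Seminorms of symmetric functions\<close>

text \<open>\<open>functional_deriv\<close> is a definite description, so a bracket says nothing
  until the derivative of \<open>F\<close> is known to be represented by a symmetric function.
  Reflexivity therefore has to be proved, and additivity of the Gateaux derivative before it. A
  candidate representer is easy to write down; the obstacle is that a functional on the dual might
  vanish on all point evaluations without being zero. This is excluded by uniform control of all
  derivatives at once: one bounded convex set dominates the functional, the candidate obeys the same
  derivative bounds as the members of that set, and hence finitely many approximate values on a net
  control a whole seminorm. Since approximate values are enough, a least squares argument can
  replace compactness and separation of convex sets.\<close>

lemma smooth_has_derivative: "smooth f \<Longrightarrow> (f has_derivative frechet_derivative f (at x)) (at x)"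
  using smooth_differentiable frechet_derivative_works by blast

lemma smooth_linear_frechet: "smooth f \<Longrightarrow> linear (frechet_derivative f (at x))"
  using smooth_has_derivative has_derivative_linear by blast

lemma frechet_derivative_smooth_add:
  "smooth f \<Longrightarrow> smooth g \<Longrightarrow> frechet_derivative (\<lambda>x. f x + g x) (at x) e =
     frechet_derivative f (at x) e + frechet_derivative g (at x) e"
  by (rule fun_cong[OF frechet_derivative_at[symmetric]], intro has_derivative_add smooth_has_derivative)

lemma frechet_derivative_smooth_mult:
  "smooth f \<Longrightarrow> smooth g \<Longrightarrow> frechet_derivative (\<lambda>x. f x * g x) (at x) e =
     f x * frechet_derivative g (at x) e + frechet_derivative f (at x) e * g x"
  by (rule fun_cong[OF frechet_derivative_at[symmetric]], intro has_derivative_mult smooth_has_derivative)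

lemma frechet_derivative_smooth_cmult:
  "smooth f \<Longrightarrow> frechet_derivative (\<lambda>x. c * f x) (at x) e = c * frechet_derivative f (at x) e"
  by (rule fun_cong[OF frechet_derivative_at[symmetric]], intro has_derivative_mult_right smooth_has_derivative)

lemma frechet_derivative_smooth_diff:
  "smooth f \<Longrightarrow> smooth g \<Longrightarrow> frechet_derivative (\<lambda>x. f x - g x) (at x) e =
     frechet_derivative f (at x) e - frechet_derivative g (at x) e"
  by (rule fun_cong[OF frechet_derivative_at[symmetric]], intro has_derivative_diff smooth_has_derivative)

lemma frechet_derivative_smooth_sum:
  "(\<And>i. i \<in> A \<Longrightarrow> smooth (f i)) \<Longrightarrow> frechet_derivative (\<lambda>x. \<Sum>i\<in>A. f i x) (at x) e =
     (\<Sum>i\<in>A. frechet_derivative (f i) (at x) e)"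
  by (rule fun_cong[OF frechet_derivative_at[symmetric]], intro has_derivative_sum smooth_has_derivative)

lemma frechet_derivative_compose_bounded_linear:
  assumes "smooth f" "bounded_linear L"
  shows "frechet_derivative (\<lambda>x. f (L x)) (at x) e = frechet_derivative f (at (L x)) (L e)"
  using has_derivative_compose[OF bounded_linear_imp_has_derivative[OF assms(2)] smooth_has_derivative[OF assms(1)], of x]
  by (intro fun_cong[OF frechet_derivative_at[symmetric]]) simp

lemma smooth_partials: "smooth f \<Longrightarrow> smooth (partials es f)"
  by (induction es) (auto intro: smooth_frechet)

lemma smooth_continuous_on: "smooth f \<Longrightarrow> continuous_on S f"
  unfolding smooth_def using Ck.simps(1) continuous_on_subset by blast

text \<open>New derivatives enter at the head of the list, outermost. Peeling off the last entry
  exposes the derivative that is applied first, on which the product rule acts.\<close>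

lemma partials_snoc: "partials (es @ [e]) f = partials es (\<lambda>x. frechet_derivative f (at x) e)"
  by (induction es) simp_all

lemma partials_add: "smooth f \<Longrightarrow> smooth g \<Longrightarrow>
    partials es (\<lambda>x. f x + g x) = (\<lambda>x. partials es f x + partials es g x)"
  by (induction es) (simp_all add: frechet_derivative_smooth_add smooth_partials)

lemma partials_diff: "smooth f \<Longrightarrow> smooth g \<Longrightarrow>
    partials es (\<lambda>x. f x - g x) = (\<lambda>x. partials es f x - partials es g x)"
  by (induction es) (simp_all add: frechet_derivative_smooth_diff smooth_partials)

lemma partials_cmult: "smooth f \<Longrightarrow> partials es (\<lambda>x. c * f x) = (\<lambda>x. c * partials es f x)"
  by (induction es) (simp_all add: frechet_derivative_smooth_cmult smooth_partials)

lemma smooth_symfun [simp]: "smooth (apply_symfun f)"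
  and symmetric_symfun: "symmetric (apply_symfun f)"
  using apply_symfun[of f] by auto

lemma symfun_eqI: "(\<And>z. apply_symfun f z = apply_symfun g z) \<Longrightarrow> f = g"
  by (simp add: apply_symfun_inject[symmetric] fun_eq_iff)

lemma partials_symfun:
  "partials es (apply_symfun (f + g)) z = partials es (apply_symfun f) z + partials es (apply_symfun g) z"
  "partials es (apply_symfun (f - g)) z = partials es (apply_symfun f) z - partials es (apply_symfun g) z"
  "partials es (apply_symfun (c *\<^sub>R f)) z = c * partials es (apply_symfun f) z"
  by (simp_all add: plus_symfun.rep_eq minus_symfun.rep_eq scaleR_symfun.rep_eq
      partials_add partials_diff partials_cmult)

lemma frechet_derivative_Basis:
  fixes f :: "'a::euclidean_space \<Rightarrow> real"
  assumes "smooth f"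
  shows "frechet_derivative f (at x) e = (\<Sum>b\<in>Basis. (e \<bullet> b) * frechet_derivative f (at x) b)"
proof -
  interpret linear "frechet_derivative f (at x)" using assms by (rule smooth_linear_frechet)
  have "frechet_derivative f (at x) (\<Sum>b\<in>Basis. (e \<bullet> b) *\<^sub>R b) =
      (\<Sum>b\<in>Basis. (e \<bullet> b) * frechet_derivative f (at x) b)"
    by (simp add: sum scale)
  then show ?thesis by (simp add: euclidean_representation)
qed

text \<open>Makes the \<open>Sup\<close> in \<open>Ck_seminorm\<close> meaningful: there are
  finitely many words of bounded length in the basis vectors, and each derivative is continuous on
  the compact set.\<close>

lemma bdd_above_Ck_seminorm:
  fixes f :: "'a::euclidean_space \<Rightarrow> real"
  assumes "smooth f" "compact K"
  shows "bdd_above {\<bar>partials es f x\<bar> | es x. set es \<subseteq> Basis \<and> length es \<le> n \<and> x \<in> K}"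
proof -
  let ?L = "{es. set es \<subseteq> (Basis::'a set) \<and> length es \<le> n}"
  have eq: "{\<bar>partials es f x\<bar> | es x. set es \<subseteq> Basis \<and> length es \<le> n \<and> x \<in> K} =
      (\<Union>es\<in>?L. (\<lambda>x. \<bar>partials es f x\<bar>) ` K)"
    by blast
  have "compact ((\<lambda>x. \<bar>partials es f x\<bar>) ` K)" for es
    by (intro compact_continuous_image continuous_on_rabs smooth_continuous_on smooth_partials assms)
  then show ?thesis
    unfolding eq
    by (subst bdd_above_UN)
      (simp_all add: finite_lists_length_le bounded_imp_bdd_above compact_imp_bounded)
qed

lemma partials_le_Ck_seminorm:
  fixes f :: "'a::euclidean_space \<Rightarrow> real"
  assumes "smooth f" "compact K" "set es \<subseteq> Basis" "length es \<le> n" "x \<in> K"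
  shows "\<bar>partials es f x\<bar> \<le> Ck_seminorm K n f"
  unfolding Ck_seminorm_def using assms by (intro cSup_upper bdd_above_Ck_seminorm) auto

lemma Ck_seminorm_least:
  assumes "K \<noteq> {}" "\<And>es x. set es \<subseteq> Basis \<Longrightarrow> length es \<le> n \<Longrightarrow> x \<in> K \<Longrightarrow> \<bar>partials es f x\<bar> \<le> M"
  shows "Ck_seminorm K n f \<le> M"
  unfolding Ck_seminorm_def
proof (rule cSup_least)
  show "{\<bar>partials es f x\<bar> |es x. set es \<subseteq> Basis \<and> length es \<le> n \<and> x \<in> K} \<noteq> {}"
    using assms(1) by (auto intro!: exI[of _ "[]"])
qed (use assms(2) in auto)

lemma Ck_seminorm_nonneg:
  fixes f :: "'a::euclidean_space \<Rightarrow> real"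
  assumes "smooth f" "compact K" "K \<noteq> {}"
  shows "0 \<le> Ck_seminorm K n f"
  using partials_le_Ck_seminorm[OF assms(1,2), of "[]" n] assms(3)
  by (metis abs_ge_zero all_not_in_conv empty_subsetI list.set(1) list.size(3) order_trans zero_le)

lemma Ck_seminorm_mono:
  fixes f :: "'a::euclidean_space \<Rightarrow> real"
  assumes "smooth f" "compact K'" "K \<noteq> {}" "K \<subseteq> K'" "n \<le> n'"
  shows "Ck_seminorm K n f \<le> Ck_seminorm K' n' f"
  using assms by (intro Ck_seminorm_least partials_le_Ck_seminorm) auto

lemma Ck_seminorm_symfun_add:
  assumes "compact K" "K \<noteq> {}"
  shows "Ck_seminorm K n (apply_symfun (f + g)) \<le>
    Ck_seminorm K n (apply_symfun f) + Ck_seminorm K n (apply_symfun g)"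
  using assms
  by (intro Ck_seminorm_least)
    (auto simp: partials_symfun intro!: order_trans[OF abs_triangle_ineq] add_mono partials_le_Ck_seminorm)

lemma Ck_seminorm_symfun_scaleR:
  assumes "compact K" "K \<noteq> {}"
  shows "Ck_seminorm K n (apply_symfun (c *\<^sub>R f)) \<le> \<bar>c\<bar> * Ck_seminorm K n (apply_symfun f)"
  using assms
  by (intro Ck_seminorm_least)
    (auto simp: partials_symfun abs_mult intro!: mult_left_mono partials_le_Ck_seminorm)

lemma Ck_seminorm_symfun_zero:
  assumes "compact K" "K \<noteq> {}"
  shows "Ck_seminorm K n (apply_symfun 0) = 0"
  using Ck_seminorm_symfun_scaleR[OF assms, of n 0 0] Ck_seminorm_nonneg[OF _ assms, of "apply_symfun 0" n]
  by simp

lemma open_Ck_ball: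
  "compact K \<Longrightarrow> K \<noteq> {} \<Longrightarrow> 0 < \<epsilon> \<Longrightarrow> open {g. Ck_seminorm K n (apply_symfun (g - f)) < \<epsilon>}"
  unfolding open_symfun_def by (intro generate_topology.Basis) blast

text \<open>Subbasic sets are balls with arbitrary centres. The triangle inequality recentres one at
  \<open>f\<close>, and the seminorms are directed (union of the compacta, maximum of the orders),
  so a finite intersection still contains a single ball.\<close>

lemma open_symfun_ball:
  fixes f :: "('d::finite, 'n::finite) symfun"
  assumes "open U" "f \<in> U"
  shows "\<exists>K n \<epsilon>. compact K \<and> K \<noteq> {} \<and> 0 < \<epsilon> \<and> {g. Ck_seminorm K n (apply_symfun (g - f)) < \<epsilon>} \<subseteq> U"
  using assms unfolding open_symfun_def
proof (induction U rule: generate_topology.induct)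
  case UNIV
  show ?case by (intro exI[of _ "{undefined}"] exI[of _ 0] exI[of _ 1]) auto
next
  case (Int U V)
  from Int.IH(1) Int.prems obtain K n \<epsilon> where
    1: "compact K" "K \<noteq> {}" "0 < \<epsilon>" "{g. Ck_seminorm K n (apply_symfun (g - f)) < \<epsilon>} \<subseteq> U"
    by blast
  from Int.IH(2) Int.prems obtain K' n' \<epsilon>' where
    2: "compact K'" "K' \<noteq> {}" "0 < \<epsilon>'" "{g. Ck_seminorm K' n' (apply_symfun (g - f)) < \<epsilon>'} \<subseteq> V"
    by blast
  have le: "Ck_seminorm K n (apply_symfun (g - f)) \<le> Ck_seminorm (K \<union> K') (max n n') (apply_symfun (g - f))"
    "Ck_seminorm K' n' (apply_symfun (g - f)) \<le> Ck_seminorm (K \<union> K') (max n n') (apply_symfun (g - f))" for g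
    using 1 2 by (auto intro!: Ck_seminorm_mono compact_Un)
  have "{g. Ck_seminorm (K \<union> K') (max n n') (apply_symfun (g - f)) < min \<epsilon> \<epsilon>'} \<subseteq> U \<inter> V"
  proof
    fix g assume "g \<in> {g. Ck_seminorm (K \<union> K') (max n n') (apply_symfun (g - f)) < min \<epsilon> \<epsilon>'}"
    then have "Ck_seminorm K n (apply_symfun (g - f)) < \<epsilon>" "Ck_seminorm K' n' (apply_symfun (g - f)) < \<epsilon>'"
      using le[of g] by auto
    then show "g \<in> U \<inter> V" using 1(4) 2(4) by blast
  qed
  with 1 2 show ?case
    by (intro exI[of _ "K \<union> K'"] exI[of _ "max n n'"] exI[of _ "min \<epsilon> \<epsilon>'"]) (auto intro: compact_Un)
next
  case (UN \<U>)
  then obtain U where "U \<in> \<U>" "f \<in> U" by blast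
  with UN(2) show ?case by (meson Sup_upper order_trans)
next
  case (Basis U)
  then obtain h K n \<epsilon> where U: "U = {g. Ck_seminorm K n (apply_symfun (g - h)) < \<epsilon>}"
    and K: "compact K" "K \<noteq> {}" by blast
  have "Ck_seminorm K n (apply_symfun (g - h)) < \<epsilon>"
    if "Ck_seminorm K n (apply_symfun (g - f)) < \<epsilon> - Ck_seminorm K n (apply_symfun (f - h))" for g
    using Ck_seminorm_symfun_add[OF K, of n "g - f" "f - h"] that by simp
  then have "{g. Ck_seminorm K n (apply_symfun (g - f)) < \<epsilon> - Ck_seminorm K n (apply_symfun (f - h))} \<subseteq> U"
    unfolding U by blast
  moreover have "0 < \<epsilon> - Ck_seminorm K n (apply_symfun (f - h))" using Basis(2) U by simp
  ultimately show ?case using K by blast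
qed

lemma continuous_on_UNIV_nhdI:
  fixes f :: "'a::topological_space \<Rightarrow> 'b::topological_space"
  assumes "\<And>x V. open V \<Longrightarrow> f x \<in> V \<Longrightarrow> \<exists>U. open U \<and> x \<in> U \<and> f ` U \<subseteq> V"
  shows "continuous_on UNIV f"
  unfolding continuous_on_open_vimage[OF open_UNIV]
proof (intro allI impI)
  fix V :: "'b set" assume V: "open V"
  have "\<exists>U. open U \<and> x \<in> U \<and> U \<subseteq> f -` V" if "x \<in> f -` V" for x
    using assms[OF V, of x] that by blast
  then show "open (f -` V \<inter> UNIV)" by (subst open_subopen) auto
qed

lemma continuous_on_symfun_functionalI:
  assumes lin: "linear \<phi>" and K: "compact K" "K \<noteq> {}"
    and bound: "\<And>f. \<bar>\<phi> f\<bar> \<le> C * Ck_seminorm K n (apply_symfun f)"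
  shows "continuous_on UNIV (\<phi> :: ('d::finite, 'n::finite) symfun \<Rightarrow> real)"
proof (rule continuous_on_UNIV_nhdI)
  fix f V assume "open V" "\<phi> f \<in> V"
  then obtain \<epsilon> where \<epsilon>: "0 < \<epsilon>" "ball (\<phi> f) \<epsilon> \<subseteq> V" by (meson open_contains_ball)
  \<comment> \<open>The summand 1 keeps the divisor positive.\<close>
  let ?U = "{g. Ck_seminorm K n (apply_symfun (g - f)) < \<epsilon> / (\<bar>C\<bar> + 1)}"
  have "g \<in> ?U \<Longrightarrow> \<phi> g \<in> V" for g
  proof -
    assume "g \<in> ?U"
    then have less: "Ck_seminorm K n (apply_symfun (g - f)) * (\<bar>C\<bar> + 1) < \<epsilon>"
      by (simp add: pos_less_divide_eq)
    have "0 \<le> Ck_seminorm K n (apply_symfun (g - f))" by (rule Ck_seminorm_nonneg[OF _ K]) simp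
    then have "C * Ck_seminorm K n (apply_symfun (g - f)) \<le> (\<bar>C\<bar> + 1) * Ck_seminorm K n (apply_symfun (g - f))"
      by (intro mult_right_mono) auto
    with less have "\<bar>\<phi> (g - f)\<bar> < \<epsilon>" using bound[of "g - f"] by (simp add: mult.commute)
    then show "\<phi> g \<in> V" using \<epsilon>(2) lin by (auto simp: dist_real_def linear_diff abs_minus_commute)
  qed
  moreover have "open ?U" using \<epsilon>(1) by (intro open_Ck_ball K) (simp add: add_nonneg_pos)
  moreover have "f \<in> ?U" using \<epsilon>(1) Ck_seminorm_symfun_zero[OF K] by (simp add: add_nonneg_pos)
  ultimately show "\<exists>U. open U \<and> f \<in> U \<and> \<phi> ` U \<subseteq> V" by blast
qed

section \<open>The duality pairing and distributions of finite order\<close>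

lemma linear_pairing: "linear (pairing \<phi>)"
  and continuous_pairing: "continuous_on UNIV (pairing \<phi>)"
  using pairing[of \<phi>] by auto

lemmas pairing_linear_simps [simp] =
  linear_add[OF linear_pairing] linear_diff[OF linear_pairing] linear_cmul[OF linear_pairing]
  linear_0[OF linear_pairing]

lemmas pairing_rep_eq [simp] = zero_strong_dual.rep_eq plus_strong_dual.rep_eq minus_strong_dual.rep_eq
  uminus_strong_dual.rep_eq scaleR_strong_dual.rep_eq

lemma pairing_eqI: "(\<And>f. pairing \<phi> f = pairing \<psi> f) \<Longrightarrow> \<phi> = \<psi>"
  by (metis ext pairing_inject)

lemma pairing_sum: "pairing (\<Sum>i\<in>A. \<phi> i) f = (\<Sum>i\<in>A. pairing (\<phi> i) f)"
  by (induction A rule: infinite_finite_induct) auto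

text \<open>Homogeneity turns boundedness on a ball into a linear estimate: \<open>c\<close> is
  chosen so that \<open>c * s\<close> is half of \<open>\<epsilon>\<close>, whence the factor 2. If
  \<open>s\<close> is 0, all multiples of \<open>x\<close> stay below 1, which forces
  \<open>x\<close> to be 0.\<close>

lemma abs_le_of_scaled_less:
  fixes s x \<epsilon> :: real
  assumes "0 \<le> s" "0 < \<epsilon>" "\<And>c. \<bar>c\<bar> * s < \<epsilon> \<Longrightarrow> \<bar>c * x\<bar> < 1"
  shows "\<bar>x\<bar> \<le> 2 / \<epsilon> * s"
proof (cases "s = 0")
  case True
  have "x = 0"
  proof (rule ccontr)
    assume "x \<noteq> 0"
    then show False using assms(3)[of "1 / x"] True assms(2) by simp
  qed
  then show ?thesis using True by simp
next
  case False
  then have "0 < s" using assms(1) by simp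
  then show ?thesis using assms(3)[of "\<epsilon> / (2 * s)"] assms(2) by (simp add: abs_mult field_simps)
qed

text \<open>The preimage of the unit ball contains a seminorm ball around 0. Enlarging the compact
  set to a ball gives a convex set for mean value estimates and leaves room for a radial
  cutoff.\<close>

lemma pairing_symfun_bound:
  fixes \<phi> :: "('d::finite, 'n::finite) symfun strong_dual"
  obtains R n C where "0 < R" "0 \<le> C" "\<And>f. \<bar>pairing \<phi> f\<bar> \<le> C * Ck_seminorm (cball 0 R) n (apply_symfun f)"
proof -
  have "open (pairing \<phi> -` ball 0 1)"
    using continuous_pairing[of \<phi>] by (auto simp: continuous_on_open_vimage)
  then obtain K n \<epsilon> where K: "compact K" "K \<noteq> {}" "0 < \<epsilon>"
    and sub: "{g. Ck_seminorm K n (apply_symfun (g - 0)) < \<epsilon>} \<subseteq> pairing \<phi> -` ball 0 1"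
    using open_symfun_ball[of "pairing \<phi> -` ball 0 1" 0] by auto
  obtain R where R: "0 < R" "K \<subseteq> cball 0 R"
    using bounded_subset_ballD[OF compact_imp_bounded[OF K(1)], of 0] ball_subset_cball by blast
  have "\<bar>pairing \<phi> f\<bar> \<le> 2 / \<epsilon> * Ck_seminorm (cball 0 R) n (apply_symfun f)" for f
  proof -
    define s where "s = Ck_seminorm (cball 0 R) n (apply_symfun f)"
    have s0: "0 \<le> s" unfolding s_def using R(1) by (intro Ck_seminorm_nonneg) auto
    have lt: "\<bar>pairing \<phi> (c *\<^sub>R f)\<bar> < 1" if c: "\<bar>c\<bar> * s < \<epsilon>" for c
    proof -
      have "Ck_seminorm K n (apply_symfun (c *\<^sub>R f)) \<le> \<bar>c\<bar> * Ck_seminorm K n (apply_symfun f)"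
        by (rule Ck_seminorm_symfun_scaleR[OF K(1,2)])
      also have "\<dots> \<le> \<bar>c\<bar> * s" unfolding s_def
        by (intro mult_left_mono Ck_seminorm_mono R K) auto
      finally have "c *\<^sub>R f \<in> pairing \<phi> -` ball 0 1" using sub c by fastforce
      then show ?thesis by simp
    qed
    show ?thesis using abs_le_of_scaled_less[OF s0 K(3), of "pairing \<phi> f"] lt
      unfolding s_def by simp
  qed
  then show thesis using that[of R "2 / \<epsilon>" n] R(1) K(3) by simp
qed

text \<open>Up to sign, a derivative of the Dirac mass at \<open>z\<close>, acting on symmetric
  functions. The list is meant to consist of basis vectors, the directions that the seminorms see;
  the functional is then continuous.\<close>

definition deriv_at :: "('d::finite, 'n::finite) config list \<Rightarrow> ('d, 'n) config \<Rightarrow> ('d, 'n) symfun strong_dual" where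
  "deriv_at es z = Abs_strong_dual (\<lambda>f. partials es (apply_symfun f) z)"

lemma pairing_deriv_at:
  assumes "set es \<subseteq> Basis"
  shows "pairing (deriv_at es z) f = partials es (apply_symfun f) z"
proof -
  have lin: "linear (\<lambda>f. partials es (apply_symfun f) z)"
    by (intro linearI) (simp_all add: partials_symfun)
  have "continuous_on UNIV (\<lambda>f. partials es (apply_symfun f) z)"
    using assms
    by (intro continuous_on_symfun_functionalI[OF lin, of "{z}" 1 "length es"])
      (auto intro: partials_le_Ck_seminorm)
  with lin show ?thesis unfolding deriv_at_def by (subst Abs_strong_dual_inverse) auto
qed

text \<open>Point evaluations already separate symmetric functions; this is the uniqueness behind
  \<open>functional_deriv\<close>.\<close>

lemma symfun_eqI_pairing:
  assumes "\<And>\<eta>. pairing \<eta> f = pairing \<eta> (g :: ('d::finite, 'n::finite) symfun)"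
  shows "f = g"
proof -
  have "apply_symfun f z = apply_symfun g z" for z
    using assms[of "deriv_at [] z"] by (simp add: pairing_deriv_at)
  then show ?thesis by (rule symfun_eqI)
qed

section \<open>Topology of the strong dual\<close>

lemma tvs_bounded_image:
  fixes T :: "'a::{real_vector,topological_space} \<Rightarrow> 'b::{real_vector,topological_space}"
  assumes T: "linear T" "continuous_on UNIV T" and B: "tvs_bounded B"
  shows "tvs_bounded (T ` B)"
  unfolding tvs_bounded_def
proof (intro allI impI, elim conjE)
  fix U :: "'b set" assume U: "open U" "0 \<in> U"
  have "open (T -` U)" "0 \<in> T -` U"
    using T U by (auto simp: continuous_on_open_vimage linear_0)
  then obtain r where r: "r > 0" "\<And>s. s \<ge> r \<Longrightarrow> B \<subseteq> (\<lambda>x. s *\<^sub>R x) ` (T -` U)"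
    using B unfolding tvs_bounded_def by blast
  have "T ` B \<subseteq> (\<lambda>x. s *\<^sub>R x) ` U" if "s \<ge> r" for s
    using r(2)[OF that] linear_scale[OF T(1)] by fastforce
  then show "\<exists>r>0. \<forall>s\<ge>r. T ` B \<subseteq> (\<lambda>x. s *\<^sub>R x) ` U" using r(1) by blast
qed

lemma tvs_bounded_Un:
  fixes A B :: "'a::{real_vector,topological_space} set"
  assumes "tvs_bounded A" "tvs_bounded B"
  shows "tvs_bounded (A \<union> B)"
  unfolding tvs_bounded_def
proof (intro allI impI)
  fix U :: "'a set" assume U: "open U \<and> 0 \<in> U"
  obtain r where r: "r > 0" "\<And>s. s \<ge> r \<Longrightarrow> A \<subseteq> (\<lambda>x. s *\<^sub>R x) ` U"
    using assms(1) U unfolding tvs_bounded_def by blast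
  obtain r' where r': "r' > 0" "\<And>s. s \<ge> r' \<Longrightarrow> B \<subseteq> (\<lambda>x. s *\<^sub>R x) ` U"
    using assms(2) U unfolding tvs_bounded_def by blast
  show "\<exists>r>0. \<forall>s\<ge>r. A \<union> B \<subseteq> (\<lambda>x. s *\<^sub>R x) ` U"
    using r r' by (intro exI[of _ "max r r'"]) auto
qed

lemma tvs_bounded_zero: "tvs_bounded {0}"
  unfolding tvs_bounded_def by (intro allI impI exI[of _ 1]) (auto intro!: image_eqI[of _ _ 0])

section \<open>Seminorms of uniform convergence on bounded sets\<close>

definition dual_seminorm :: "'a::{real_vector,topological_space} set \<Rightarrow> 'a strong_dual \<Rightarrow> real" where
  "dual_seminorm B \<phi> = (SUP x\<in>B. \<bar>pairing \<phi> x\<bar>)"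

text \<open>A bounded set is absorbed by the neighbourhood of 0 on which the functional is below 1
  in modulus, so the supremum is taken over a bounded set of reals.\<close>

lemma abs_pairing_le_dual_seminorm:
  assumes "tvs_bounded B" "x \<in> B"
  shows "\<bar>pairing \<phi> x\<bar> \<le> dual_seminorm B \<phi>"
proof -
  have "open (pairing \<phi> -` ball 0 1)" "0 \<in> pairing \<phi> -` ball 0 1"
    using continuous_pairing[of \<phi>] by (auto simp: continuous_on_open_vimage)
  then have "\<exists>r>0. \<forall>s\<ge>r. B \<subseteq> (\<lambda>x. s *\<^sub>R x) ` (pairing \<phi> -` ball 0 1)"
    using assms(1) unfolding tvs_bounded_def by blast
  then obtain r where r: "r > 0" "B \<subseteq> (\<lambda>x. r *\<^sub>R x) ` (pairing \<phi> -` ball 0 1)"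
    by blast
  have "\<bar>pairing \<phi> y\<bar> \<le> r" if "y \<in> B" for y
  proof -
    from that r(2) obtain u where "y = r *\<^sub>R u" "u \<in> pairing \<phi> -` ball 0 1" by blast
    then have "y = r *\<^sub>R u" "\<bar>pairing \<phi> u\<bar> < 1" by auto
    then show ?thesis using r(1) mult_left_mono[of "\<bar>pairing \<phi> u\<bar>" 1 r] by (simp add: abs_mult)
  qed
  then show ?thesis unfolding dual_seminorm_def
    using assms(2) by (intro cSUP_upper bdd_aboveI2)
qed

lemma dual_seminorm_least:
  "B \<noteq> {} \<Longrightarrow> (\<And>x. x \<in> B \<Longrightarrow> \<bar>pairing \<phi> x\<bar> \<le> M) \<Longrightarrow> dual_seminorm B \<phi> \<le> M"
  unfolding dual_seminorm_def by (intro cSUP_least)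

lemma dual_seminorm_nonneg: "tvs_bounded B \<Longrightarrow> B \<noteq> {} \<Longrightarrow> 0 \<le> dual_seminorm B \<phi>"
  using abs_pairing_le_dual_seminorm by (metis abs_ge_zero all_not_in_conv order_trans)

lemma dual_seminorm_add:
  "tvs_bounded B \<Longrightarrow> B \<noteq> {} \<Longrightarrow> dual_seminorm B (\<phi> + \<psi>) \<le> dual_seminorm B \<phi> + dual_seminorm B \<psi>"
  by (intro dual_seminorm_least)
    (auto intro!: order_trans[OF abs_triangle_ineq] add_mono abs_pairing_le_dual_seminorm)

lemma dual_seminorm_scaleR:
  "tvs_bounded B \<Longrightarrow> B \<noteq> {} \<Longrightarrow> dual_seminorm B (c *\<^sub>R \<phi>) \<le> \<bar>c\<bar> * dual_seminorm B \<phi>"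
  by (intro dual_seminorm_least) (auto simp: abs_mult intro!: mult_left_mono abs_pairing_le_dual_seminorm)

lemma dual_seminorm_zero [simp]: "B \<noteq> {} \<Longrightarrow> dual_seminorm B 0 = 0"
  by (simp add: dual_seminorm_def)

lemma dual_seminorm_mono:
  "tvs_bounded B' \<Longrightarrow> B \<noteq> {} \<Longrightarrow> B \<subseteq> B' \<Longrightarrow> dual_seminorm B \<phi> \<le> dual_seminorm B' \<phi>"
  by (intro dual_seminorm_least) (auto intro: abs_pairing_le_dual_seminorm)

lemma open_dual_ball:
  "tvs_bounded B \<Longrightarrow> B \<noteq> {} \<Longrightarrow> 0 < \<epsilon> \<Longrightarrow> open {\<psi>. dual_seminorm B (\<psi> - \<phi>) < \<epsilon>}"
  unfolding open_strong_dual_def dual_seminorm_def minus_strong_dual.rep_eq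
  by (intro generate_topology.Basis) blast

text \<open>Same argument as for \<open>open_symfun_ball\<close>; here the seminorms are directed
  because the union of two bounded sets is bounded.\<close>

lemma open_strong_dual_ball:
  assumes "open U" "\<phi> \<in> U"
  shows "\<exists>B \<epsilon>. tvs_bounded B \<and> B \<noteq> {} \<and> 0 < \<epsilon> \<and> {\<psi>. dual_seminorm B (\<psi> - \<phi>) < \<epsilon>} \<subseteq> U"
  using assms unfolding open_strong_dual_def
proof (induction U rule: generate_topology.induct)
  case UNIV
  show ?case by (intro exI[of _ "{0}"] exI[of _ 1]) (auto simp: tvs_bounded_zero)
next
  case (Int U V)
  from Int.IH(1) Int.prems obtain B \<epsilon> where
    1: "tvs_bounded B" "B \<noteq> {}" "0 < \<epsilon>" "{\<psi>. dual_seminorm B (\<psi> - \<phi>) < \<epsilon>} \<subseteq> U"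
    by blast
  from Int.IH(2) Int.prems obtain B' \<epsilon>' where
    2: "tvs_bounded B'" "B' \<noteq> {}" "0 < \<epsilon>'" "{\<psi>. dual_seminorm B' (\<psi> - \<phi>) < \<epsilon>'} \<subseteq> V"
    by blast
  have le: "dual_seminorm B \<theta> \<le> dual_seminorm (B \<union> B') \<theta>"
    "dual_seminorm B' \<theta> \<le> dual_seminorm (B \<union> B') \<theta>" for \<theta>
    using 1 2 by (auto intro!: dual_seminorm_mono tvs_bounded_Un)
  have "{\<psi>. dual_seminorm (B \<union> B') (\<psi> - \<phi>) < min \<epsilon> \<epsilon>'} \<subseteq> U \<inter> V"
  proof
    fix \<psi> assume "\<psi> \<in> {\<psi>. dual_seminorm (B \<union> B') (\<psi> - \<phi>) < min \<epsilon> \<epsilon>'}"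
    then have "dual_seminorm B (\<psi> - \<phi>) < \<epsilon>" "dual_seminorm B' (\<psi> - \<phi>) < \<epsilon>'"
      using le[of "\<psi> - \<phi>"] by auto
    then show "\<psi> \<in> U \<inter> V" using 1(4) 2(4) by blast
  qed
  with 1 2 show ?case
    by (intro exI[of _ "B \<union> B'"] exI[of _ "min \<epsilon> \<epsilon>'"]) (auto intro: tvs_bounded_Un)
next
  case (UN \<U>)
  then obtain U where "U \<in> \<U>" "\<phi> \<in> U" by blast
  with UN(2) show ?case by (meson Sup_upper order_trans)
next
  case (Basis U)
  then obtain \<theta> B \<epsilon> where U: "U = {\<psi>. dual_seminorm B (\<psi> - \<theta>) < \<epsilon>}"
    and B: "tvs_bounded B" "B \<noteq> {}"
    unfolding dual_seminorm_def minus_strong_dual.rep_eq by blast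
  have "dual_seminorm B (\<psi> - \<theta>) < \<epsilon>"
    if "dual_seminorm B (\<psi> - \<phi>) < \<epsilon> - dual_seminorm B (\<phi> - \<theta>)" for \<psi>
    using dual_seminorm_add[OF B, of "\<psi> - \<phi>" "\<phi> - \<theta>"] that by simp
  then have "{\<psi>. dual_seminorm B (\<psi> - \<phi>) < \<epsilon> - dual_seminorm B (\<phi> - \<theta>)} \<subseteq> U"
    unfolding U by blast
  moreover have "0 < \<epsilon> - dual_seminorm B (\<phi> - \<theta>)" using Basis(2) U by simp
  ultimately show ?case using B by blast
qed

text \<open>Continuity at 0 singles out one bounded set whose uniform norm dominates the functional;
  in the reflexivity proof all bounds descend from it.\<close>

lemma strong_dual_functional_bound:
  fixes \<Lambda> :: "'a::{real_vector,topological_space} strong_dual \<Rightarrow> real"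
  assumes \<Lambda>: "linear \<Lambda>" "continuous_on UNIV \<Lambda>"
  obtains B C where "tvs_bounded B" "B \<noteq> {}" "0 \<le> C" "\<And>\<phi>. \<bar>\<Lambda> \<phi>\<bar> \<le> C * dual_seminorm B \<phi>"
proof -
  have "open (\<Lambda> -` ball 0 1)"
    using \<Lambda>(2) by (auto simp: continuous_on_open_vimage)
  then obtain B \<epsilon> where B: "tvs_bounded B" "B \<noteq> {}" "0 < \<epsilon>"
    and sub: "{\<psi>. dual_seminorm B (\<psi> - 0) < \<epsilon>} \<subseteq> \<Lambda> -` ball 0 1"
    using open_strong_dual_ball[of "\<Lambda> -` ball 0 1" 0] linear_0[OF \<Lambda>(1)] by auto
  have "\<bar>\<Lambda> \<phi>\<bar> \<le> 2 / \<epsilon> * dual_seminorm B \<phi>" for \<phi>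
  proof (rule abs_le_of_scaled_less[OF dual_seminorm_nonneg[OF B(1,2)] B(3)])
    fix c assume "\<bar>c\<bar> * dual_seminorm B \<phi> < \<epsilon>"
    then have "c *\<^sub>R \<phi> \<in> \<Lambda> -` ball 0 1"
      using sub dual_seminorm_scaleR[OF B(1,2), of c \<phi>] by fastforce
    then show "\<bar>c * \<Lambda> \<phi>\<bar> < 1" by (simp add: linear_cmul[OF \<Lambda>(1)])
  qed
  then show thesis using that[of B "2 / \<epsilon>"] B by simp
qed

section \<open>Transposes of linear maps, evaluations and limits in the dual\<close>

definition transpose_dual ::
  "('a::{real_vector,topological_space} \<Rightarrow> 'b::{real_vector,topological_space}) \<Rightarrow> 'b strong_dual \<Rightarrow> 'a strong_dual" where
  "transpose_dual T \<phi> = Abs_strong_dual (\<lambda>x. pairing \<phi> (T x))"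

lemma pairing_transpose_dual:
  assumes "linear T" "continuous_on UNIV T"
  shows "pairing (transpose_dual T \<phi>) x = pairing \<phi> (T x)"
proof -
  have "linear (\<lambda>x. pairing \<phi> (T x))"
    using linear_compose[OF assms(1) linear_pairing, of \<phi>] by (simp add: o_def)
  moreover have "continuous_on UNIV (\<lambda>x. pairing \<phi> (T x))"
    using continuous_on_compose2[OF continuous_pairing assms(2)] by simp
  ultimately show ?thesis unfolding transpose_dual_def by (subst Abs_strong_dual_inverse) auto
qed

lemma linear_transpose_dual:
  assumes "linear T" "continuous_on UNIV T"
  shows "linear (transpose_dual T)"
  by (intro linearI pairing_eqI) (simp_all add: pairing_transpose_dual[OF assms])

text \<open>\<open>T\<close> maps bounded sets to bounded sets, and the seminorm of a transpose over
  \<open>B\<close> is a seminorm over the image of \<open>B\<close>.\<close>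

lemma continuous_transpose_dual:
  assumes "linear T" "continuous_on UNIV T"
  shows "continuous_on UNIV (transpose_dual T)"
proof (rule continuous_on_UNIV_nhdI)
  fix \<phi> V assume "open V" "transpose_dual T \<phi> \<in> V"
  from open_strong_dual_ball[OF this] obtain B \<epsilon> where B: "tvs_bounded B" "B \<noteq> {}" "0 < \<epsilon>"
    and V: "{\<psi>. dual_seminorm B (\<psi> - transpose_dual T \<phi>) < \<epsilon>} \<subseteq> V" by blast
  have eq: "dual_seminorm (T ` B) (\<psi> - \<phi>) = dual_seminorm B (transpose_dual T \<psi> - transpose_dual T \<phi>)" for \<psi>
    by (simp add: dual_seminorm_def pairing_transpose_dual[OF assms] image_image)
  let ?U = "{\<psi>. dual_seminorm (T ` B) (\<psi> - \<phi>) < \<epsilon>}"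
  have "open ?U" using B by (intro open_dual_ball tvs_bounded_image assms) auto
  moreover have "\<phi> \<in> ?U" using B by simp
  moreover have "transpose_dual T ` ?U \<subseteq> V" using V unfolding eq by blast
  ultimately show "\<exists>U. open U \<and> \<phi> \<in> U \<and> transpose_dual T ` U \<subseteq> V" by blast
qed

text \<open>The class constraints do not tie the topology to the vector operations, so boundedness
  of a point is derived from the seminorms. It makes evaluation at \<open>h\<close> continuous on
  the dual.\<close>

lemma tvs_bounded_symfun_singleton: "tvs_bounded {h :: ('d::finite, 'n::finite) symfun}"
  unfolding tvs_bounded_def
proof (intro allI impI)
  fix U :: "('d, 'n) symfun set" assume "open U \<and> 0 \<in> U"
  then have "open U" "0 \<in> U" by auto
  from open_symfun_ball[OF this] obtain K n \<epsilon> where K: "compact K" "K \<noteq> {}" "0 < \<epsilon>"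
    and U: "{g. Ck_seminorm K n (apply_symfun (g - 0)) < \<epsilon>} \<subseteq> U"
    by blast
  define p where "p = Ck_seminorm K n (apply_symfun h)"
  have p: "0 \<le> p" unfolding p_def by (rule Ck_seminorm_nonneg[OF _ K(1,2)]) simp
  have "h \<in> (\<lambda>x. s *\<^sub>R x) ` U" if s: "s \<ge> (p + 1) / \<epsilon>" for s
  proof -
    have "0 < (p + 1) / \<epsilon>" using p K by simp
    then have s0: "0 < s" using s by simp
    have "Ck_seminorm K n (apply_symfun ((1 / s) *\<^sub>R h)) \<le> p / s"
      using Ck_seminorm_symfun_scaleR[OF K(1,2), of n "1 / s" h] s0 by (simp add: p_def)
    also have "\<dots> < \<epsilon>" using s s0 K(3) by (simp add: field_simps)
    finally have "(1 / s) *\<^sub>R h \<in> U" using U by auto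
    moreover have "h = s *\<^sub>R ((1 / s) *\<^sub>R h)" using s0 by simp
    ultimately show ?thesis by (rule rev_image_eqI)
  qed
  moreover have "0 < (p + 1) / \<epsilon>" using p K by simp
  ultimately show "\<exists>r>0. \<forall>s\<ge>r. {h} \<subseteq> (\<lambda>x. s *\<^sub>R x) ` U" by blast
qed

lemma linear_pairing_left: "linear (\<lambda>\<phi>. pairing \<phi> h)"
  by (rule linearI) simp_all

lemma continuous_pairing_left:
  assumes "tvs_bounded {h}"
  shows "continuous_on UNIV (\<lambda>\<phi>. pairing \<phi> h)"
proof (rule continuous_on_UNIV_nhdI)
  fix \<phi> and V :: "real set" assume "open V" "pairing \<phi> h \<in> V"
  then obtain \<epsilon> where \<epsilon>: "0 < \<epsilon>" "ball (pairing \<phi> h) \<epsilon> \<subseteq> V" by (meson open_contains_ball)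
  let ?U = "{\<psi>. dual_seminorm {h} (\<psi> - \<phi>) < \<epsilon>}"
  have "(\<lambda>\<phi>. pairing \<phi> h) ` ?U \<subseteq> V"
    using \<epsilon>(2) by (auto simp: dual_seminorm_def dist_real_def abs_minus_commute)
  moreover have "open ?U" using \<epsilon>(1) by (intro open_dual_ball assms) auto
  moreover have "\<phi> \<in> ?U" using \<epsilon>(1) by simp
  ultimately show "\<exists>U. open U \<and> \<phi> \<in> U \<and> (\<lambda>\<phi>. pairing \<phi> h) ` U \<subseteq> V" by blast
qed

lemma tendsto_strong_dualI:
  assumes "\<And>B. tvs_bounded B \<Longrightarrow> B \<noteq> {} \<Longrightarrow> ((\<lambda>i. dual_seminorm B (f i - \<phi>)) \<longlongrightarrow> 0) F"
  shows "(f \<longlongrightarrow> \<phi>) F"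
proof (rule topological_tendstoI)
  fix U assume "open U" "\<phi> \<in> U"
  from open_strong_dual_ball[OF this] obtain B \<epsilon> where B: "tvs_bounded B" "B \<noteq> {}" "0 < \<epsilon>"
    and U: "{\<psi>. dual_seminorm B (\<psi> - \<phi>) < \<epsilon>} \<subseteq> U" by blast
  have "\<forall>\<^sub>F i in F. dual_seminorm B (f i - \<phi>) < \<epsilon>"
    using assms[OF B(1,2)] B(3) by (rule order_tendstoD(2))
  then show "\<forall>\<^sub>F i in F. f i \<in> U" by eventually_elim (use U in blast)
qed

text \<open>The instance of continuity of the vector operations used for additivity of the Gateaux
  derivative, where the base point moves along two directions at once.\<close>

lemma tendsto_strong_dual_affine:
  fixes \<phi> :: "'a::{real_vector,topological_space} strong_dual"
  assumes "(a \<longlongrightarrow> 0) F" "(b \<longlongrightarrow> 0) F"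
  shows "((\<lambda>i. \<phi> + a i *\<^sub>R u + b i *\<^sub>R v) \<longlongrightarrow> \<phi>) F"
proof (rule tendsto_strong_dualI)
  fix B :: "'a set" assume B: "tvs_bounded B" "B \<noteq> {}"
  have le: "dual_seminorm B (\<phi> + a i *\<^sub>R u + b i *\<^sub>R v - \<phi>) \<le>
      \<bar>a i\<bar> * dual_seminorm B u + \<bar>b i\<bar> * dual_seminorm B v" for i
  proof -
    have "\<phi> + a i *\<^sub>R u + b i *\<^sub>R v - \<phi> = a i *\<^sub>R u + b i *\<^sub>R v" by simp
    then show ?thesis
      using dual_seminorm_add[OF B, of "a i *\<^sub>R u" "b i *\<^sub>R v"]
        dual_seminorm_scaleR[OF B, of "a i" u] dual_seminorm_scaleR[OF B, of "b i" v] by simp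
  qed
  show "((\<lambda>i. dual_seminorm B (\<phi> + a i *\<^sub>R u + b i *\<^sub>R v - \<phi>)) \<longlongrightarrow> 0) F"
  proof (rule tendsto_sandwich[where f = "\<lambda>_. 0"])
    show "((\<lambda>i. \<bar>a i\<bar> * dual_seminorm B u + \<bar>b i\<bar> * dual_seminorm B v) \<longlongrightarrow> 0) F"
      by (intro tendsto_add_zero tendsto_mult_left_zero tendsto_rabs_zero assms)
  qed (use le dual_seminorm_nonneg[OF B] in auto)
qed

text \<open>Evaluation at a function that distinguishes the two functionals pulls back disjoint open
  sets of reals. Uniqueness of limits makes \<open>gateaux\<close> usable for vector fields on the
  dual.\<close>

lemma Hausdorff_symfun_strong_dual:
  "Hausdorff_space (euclidean :: ('d::finite, 'n::finite) symfun strong_dual topology)"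
  unfolding Hausdorff_space_def
proof (intro allI impI, elim conjE)
  fix \<phi> \<psi> :: "('d, 'n) symfun strong_dual"
  assume "\<phi> \<noteq> \<psi>"
  then obtain h where "pairing \<phi> h \<noteq> pairing \<psi> h" using pairing_eqI by blast
  from hausdorff[OF this] obtain U V where UV: "open U" "open V" "pairing \<phi> h \<in> U" "pairing \<psi> h \<in> V" "U \<inter> V = {}"
    by blast
  have "open ((\<lambda>\<phi>. pairing \<phi> h) -` S)" if "open S" for S
    using continuous_pairing_left[OF tvs_bounded_symfun_singleton, of h] that
    by (auto simp: continuous_on_open_vimage)
  with UV show "\<exists>U V. openin euclidean U \<and> openin euclidean V \<and> \<phi> \<in> U \<and> \<psi> \<in> V \<and> disjnt U V"
    by (intro exI[of _ "(\<lambda>\<phi>. pairing \<phi> h) -` U"] exI[of _ "(\<lambda>\<phi>. pairing \<phi> h) -` V"])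
      (auto simp: disjnt_def)
qed

section \<open>Gateaux calculus on the strong dual\<close>

lemma gateauxI:
  fixes F :: "'x::{real_vector,topological_space} \<Rightarrow> 'y::{real_vector,topological_space}"
  assumes "Hausdorff_space (euclidean :: 'y topology)" "has_gateaux UNIV F x v y"
  shows "gateaux UNIV F x v = y"
  unfolding gateaux_def
proof (rule the_equality)
  show "has_gateaux UNIV F x v y" by (rule assms(2))
next
  fix z assume "has_gateaux UNIV F x v z"
  with assms show "z = y"
    unfolding has_gateaux_def
    by (auto simp flip: limitin_canonical_iff intro: limitin_Hausdorff_unique)
qed

lemma has_gateaux_const: "has_gateaux UNIV (\<lambda>x. c) x v 0"
  unfolding has_gateaux_def by simp

lemma has_gateaux_linear:
  assumes "linear L"
  shows "has_gateaux UNIV L x v (L v)"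
  unfolding has_gateaux_def
proof (rule tendsto_eventually)
  show "\<forall>\<^sub>F t in at 0 within {t. x + t *\<^sub>R v \<in> UNIV}. (1 / t) *\<^sub>R (L (x + t *\<^sub>R v) - L x) = L v"
    by (auto simp: eventually_at linear_add[OF assms] linear_scale[OF assms] intro!: exI[of _ 1])
qed

text \<open>The first derivative is independent of the base point, so all later ones vanish. Joint
  continuity then concerns three maps: \<open>L\<close> itself, \<open>L\<close> of the first
  direction, and 0.\<close>

lemma gateaux_smooth_linear:
  fixes L :: "'x::{real_vector,topological_space} \<Rightarrow> 'y::{real_vector,topological_space}"
  assumes H: "Hausdorff_space (euclidean :: 'y topology)"
    and L: "linear L" "continuous_on UNIV L"
  shows "gateaux_smooth UNIV L" and "gateaux UNIV L x v = L v"
proof -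
  have L': "gateaux UNIV L x v = L v" for x v
    by (intro gateauxI H has_gateaux_linear L)
  then show "gateaux UNIV L x v = L v" .
  have iter1: "iter_gateaux UNIV L (Suc 0) x vs = L (vs 0)" for x vs
    by (simp add: L')
  have iter2: "iter_gateaux UNIV L (Suc (Suc n)) x vs = 0" for n x vs
  proof (induction n arbitrary: x)
    case 0
    have "iter_gateaux UNIV L (Suc (Suc 0)) x vs = gateaux UNIV (\<lambda>y. L (vs 0)) x (vs (Suc 0))"
      using iter1 by simp
    also have "\<dots> = 0" by (intro gateauxI H has_gateaux_const)
    finally show ?case .
  next
    case (Suc n)
    have "iter_gateaux UNIV L (Suc (Suc (Suc n))) x vs = gateaux UNIV (\<lambda>y. 0) x (vs (Suc (Suc n)))"
      using Suc by simp
    also have "\<dots> = 0" by (intro gateauxI H has_gateaux_const)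
    finally show ?case .
  qed
  show "gateaux_smooth UNIV L"
    unfolding gateaux_smooth_def
  proof (intro allI)
    fix n
    consider "n = 0" | "n = Suc 0" | m where "n = Suc (Suc m)" by (metis not0_implies_Suc)
    then show "(\<forall>x\<in>UNIV. \<forall>vs. \<exists>y. has_gateaux UNIV (\<lambda>x. iter_gateaux UNIV L n x vs) x (vs n) y) \<and>
          continuous_map
            (prod_topology (top_of_set UNIV) (product_topology (\<lambda>_. euclidean) {..<n})) euclidean
            (\<lambda>(x, vs). iter_gateaux UNIV L n x vs)"
    proof cases
      case 1
      have "continuous_map (prod_topology euclidean (product_topology (\<lambda>_. euclidean) {..<n})) euclidean (L \<circ> fst)"
        using L(2) by (intro continuous_map_compose[OF continuous_map_fst]) simp
      with 1 show ?thesis using has_gateaux_linear[OF L(1)] by (auto simp: case_prod_unfold o_def)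
    next
      case 2
      have "continuous_map (prod_topology euclidean (product_topology (\<lambda>_. euclidean) {..<n})) euclidean
          (L \<circ> ((\<lambda>vs. vs 0) \<circ> snd))"
        using L(2) 2
        by (intro continuous_map_compose[OF continuous_map_compose[OF continuous_map_snd continuous_map_product_projection]])
          auto
      with 2 show ?thesis using has_gateaux_const unfolding 2 iter1 by (auto simp: case_prod_unfold o_def)
    next
      case 3
      then show ?thesis using has_gateaux_const unfolding 3 iter2 by (auto simp: case_prod_unfold)
    qed
  qed
qed

section \<open>Derivatives of real-valued functionals on a strong dual\<close>

context
  fixes F :: "'a::{real_vector,topological_space} strong_dual \<Rightarrow> real"
  assumes F: "gateaux_smooth UNIV F"
begin

lemma has_gateaux_gateaux: "has_gateaux UNIV F x v (gateaux UNIV F x v)"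
proof -
  have "\<forall>x vs. \<exists>y. has_gateaux UNIV F x (vs (0::nat)) y"
    using F[unfolded gateaux_smooth_def, THEN spec, of 0, THEN conjunct1] by simp
  from this[THEN spec, THEN spec, of x "\<lambda>_. v"] obtain y where y: "has_gateaux UNIV F x v y" by blast
  then show ?thesis using gateauxI[OF Hausdorff_space_euclidean y] by simp
qed

lemma DERIV_gateaux:
  "((\<lambda>s. F (x + s *\<^sub>R v)) has_real_derivative gateaux UNIV F (x + s *\<^sub>R v) v) (at s)"
  using has_gateaux_gateaux[of "x + s *\<^sub>R v" v]
  unfolding DERIV_def has_gateaux_def by (simp add: algebra_simps divide_inverse)

text \<open>Joint continuity is assumed for directions collected in a product over
  \<open>{..<n}\<close>; for \<open>n = 1\<close> a single direction is embedded as a function on a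
  one-point index set.\<close>

lemma continuous_gateaux: "continuous_on UNIV (\<lambda>p. gateaux UNIV F (fst p) (snd p))"
proof -
  have "continuous_map (prod_topology euclidean (product_topology (\<lambda>_. euclidean) {..<Suc 0})) euclidean
      (\<lambda>(x, vs). gateaux UNIV F x (vs 0))"
    using F[unfolded gateaux_smooth_def, THEN spec, of "Suc 0", THEN conjunct2]
    by (simp add: case_prod_unfold)
  moreover have "continuous_map (prod_topology euclidean euclidean)
      (prod_topology euclidean (product_topology (\<lambda>_. euclidean) {..<Suc 0}))
      (\<lambda>p :: 'a strong_dual \<times> 'a strong_dual. (fst p, \<lambda>i\<in>{..<Suc 0}. snd p))"
    by (intro continuous_map_pairedI continuous_map_fst)
      (auto simp: continuous_map_componentwise intro!: continuous_on_snd continuous_on_id)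
  ultimately have "continuous_map (prod_topology euclidean euclidean) euclidean
      ((\<lambda>(x, vs). gateaux UNIV F x (vs 0)) \<circ> (\<lambda>p. (fst p, \<lambda>i\<in>{..<Suc 0}. snd p)))"
    by (rule continuous_map_compose[rotated])
  then show ?thesis by (simp add: euclidean_product_topology o_def)
qed

lemma gateaux_scaleR: "gateaux UNIV F x (c *\<^sub>R v) = c * gateaux UNIV F x v"
proof -
  have "((\<lambda>s. F (x + (c * s) *\<^sub>R v)) has_real_derivative gateaux UNIV F x v * c) (at 0)"
    using DERIV_chain2[of "\<lambda>s. F (x + s *\<^sub>R v)" _ "\<lambda>s. c * s" 0 c]
      DERIV_gateaux[of x v "0"] by (auto intro!: derivative_eq_intros)
  moreover have "((\<lambda>s. F (x + s *\<^sub>R (c *\<^sub>R v))) has_real_derivative gateaux UNIV F x (c *\<^sub>R v)) (at 0)"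
    using DERIV_gateaux[of x "c *\<^sub>R v" 0] by simp
  ultimately show ?thesis using DERIV_unique by (fastforce simp: mult.commute)
qed

text \<open>
  Gateaux derivatives need not be additive in general; here the mean value theorem and joint
  continuity of the derivative make them so.
\<close>

lemma gateaux_add: "gateaux UNIV F x (u + v) = gateaux UNIV F x u + gateaux UNIV F x v"
proof -
  \<comment> \<open>The path runs from \<open>x\<close> to \<open>x + t *\<^sub>R u\<close> and then
    in direction \<open>v\<close>; the mean value theorem is applied to the second leg.\<close>
  have "\<exists>s. 0 < s \<and> s < t \<and>
      F (x + t *\<^sub>R (u + v)) - F (x + t *\<^sub>R u) = t * gateaux UNIV F (x + t *\<^sub>R u + s *\<^sub>R v) v" if "t > 0" for t
    using MVT2[OF that, of "\<lambda>s. F (x + t *\<^sub>R u + s *\<^sub>R v)" "\<lambda>s. gateaux UNIV F (x + t *\<^sub>R u + s *\<^sub>R v) v"]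
      DERIV_gateaux[of "x + t *\<^sub>R u" v] by (auto simp: scaleR_add_right add.assoc)
  then obtain s where s: "\<And>t. t > 0 \<Longrightarrow> 0 < s t \<and> s t < t \<and>
      F (x + t *\<^sub>R (u + v)) - F (x + t *\<^sub>R u) = t * gateaux UNIV F (x + t *\<^sub>R u + s t *\<^sub>R v) v"
    by metis
  have pos: "\<forall>\<^sub>F t :: real in at_right 0. t > 0" by (rule eventually_at_right_less)
  have lim: "((\<lambda>t. (F (x + t *\<^sub>R w) - F x) / t) \<longlongrightarrow> gateaux UNIV F x w) (at_right 0)" for w
    using has_gateaux_gateaux[of x w] unfolding has_gateaux_def
    by (auto simp: divide_inverse mult.commute intro: filterlim_mono at_le)
  have s0: "(s \<longlongrightarrow> 0) (at_right 0)"
    by (rule tendsto_sandwich[where f = "\<lambda>_. 0" and h = "\<lambda>t. t"])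
      (use s in \<open>auto intro: eventually_mono[OF pos] less_imp_le\<close>)
  have "((\<lambda>t. x + t *\<^sub>R u + s t *\<^sub>R v) \<longlongrightarrow> x) (at_right 0)"
    by (intro tendsto_strong_dual_affine s0 tendsto_ident_at)
  then have "((\<lambda>t. gateaux UNIV F (x + t *\<^sub>R u + s t *\<^sub>R v) v) \<longlongrightarrow> gateaux UNIV F x v) (at_right 0)"
    using continuous_on_tendsto_compose[OF continuous_gateaux tendsto_Pair[OF _ tendsto_const]] by simp
  from tendsto_add[OF lim[of u] this]
  have "((\<lambda>t. (F (x + t *\<^sub>R (u + v)) - F x) / t) \<longlongrightarrow> gateaux UNIV F x u + gateaux UNIV F x v) (at_right 0)"
  proof (rule Lim_transform_eventually)
    show "\<forall>\<^sub>F t in at_right 0. (F (x + t *\<^sub>R u) - F x) / t + gateaux UNIV F (x + t *\<^sub>R u + s t *\<^sub>R v) v =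
        (F (x + t *\<^sub>R (u + v)) - F x) / t"
      using pos
    proof eventually_elim
      case (elim t)
      then show ?case using s[OF elim] by (simp add: field_simps)
    qed
  qed
  from tendsto_unique[OF _ lim this] show ?thesis by simp
qed

lemma linear_gateaux: "linear (gateaux UNIV F x)"
  by (rule linearI) (simp_all add: gateaux_add gateaux_scaleR)

lemma continuous_gateaux_direction: "continuous_on UNIV (gateaux UNIV F x)"
  using continuous_on_compose2[OF continuous_gateaux, of UNIV "\<lambda>v. (x, v)"]
  by (simp add: continuous_on_Pair)

end

section \<open>Approximate solution of finite moment problems\<close>

lemma abs_linear_le_Basis:
  fixes g :: "'a::euclidean_space \<Rightarrow> real"
  assumes "linear g" "\<And>b. b \<in> Basis \<Longrightarrow> \<bar>g b\<bar> \<le> M"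
  shows "\<bar>g e\<bar> \<le> real DIM('a) * M * norm e"
proof -
  have "g e = g (\<Sum>b\<in>Basis. (e \<bullet> b) *\<^sub>R b)" by (simp add: euclidean_representation)
  also have "\<dots> = (\<Sum>b\<in>Basis. (e \<bullet> b) * g b)"
    by (simp add: linear_sum[OF assms(1)] linear_cmul[OF assms(1)])
  also have "\<bar>\<dots>\<bar> \<le> (\<Sum>b\<in>(Basis::'a set). norm e * M)"
    by (intro order_trans[OF sum_abs] sum_mono)
      (simp add: abs_mult mult_mono Basis_le_norm assms(2))
  finally show ?thesis by (simp add: mult_ac)
qed

text \<open>Mean value inequality phrased with coordinate derivatives, which are what the seminorms
  control; the dimension is the price.\<close>

lemma smooth_Lipschitz_on_convex:
  fixes f :: "'a::euclidean_space \<Rightarrow> real"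
  assumes "smooth f" "convex S" "x \<in> S" "y \<in> S"
    and "\<And>b z. b \<in> Basis \<Longrightarrow> z \<in> S \<Longrightarrow> \<bar>frechet_derivative f (at z) b\<bar> \<le> M"
  shows "\<bar>f y - f x\<bar> \<le> real DIM('a) * M * norm (y - x)"
proof -
  have "norm (f y - f x) \<le> real DIM('a) * M * norm (y - x)"
  proof (rule differentiable_bound[OF assms(2) _ _ assms(4,3)])
    show "(f has_derivative frechet_derivative f (at z)) (at z within S)" if "z \<in> S" for z
      using smooth_has_derivative[OF assms(1)] by (rule has_derivative_at_withinI)
    show "onorm (frechet_derivative f (at z)) \<le> real DIM('a) * M" if "z \<in> S" for z
      using abs_linear_le_Basis[OF smooth_linear_frechet[OF assms(1)] assms(5)] that
      by (intro onorm_le) auto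
  qed
  then show ?thesis by simp
qed

text \<open>The mean value inequality is used twice on the ball of radius \<open>norm h\<close>: for
  the first partials, and then for \<open>f\<close> minus its linear part, whose derivative is small
  by the first use. Each use contributes one dimension and one factor \<open>norm h\<close>.\<close>

lemma smooth_Taylor_bound:
  fixes f :: "'a::euclidean_space \<Rightarrow> real"
  assumes f: "smooth f"
    and M: "\<And>b c y. b \<in> Basis \<Longrightarrow> c \<in> Basis \<Longrightarrow> y \<in> cball z 1 \<Longrightarrow> \<bar>partials [c, b] f y\<bar> \<le> M"
    and h: "norm h \<le> 1"
  shows "\<bar>f (z + h) - f z - frechet_derivative f (at z) h\<bar> \<le> real DIM('a) * (real DIM('a) * M) * norm h * norm h"
proof -
  let ?S = "cball z (norm h)"
  have S: "?S \<subseteq> cball z 1" using h by auto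
  have 1: "\<bar>frechet_derivative f (at y) b - frechet_derivative f (at z) b\<bar> \<le> real DIM('a) * M * norm h"
    if y: "y \<in> ?S" and b: "b \<in> Basis" for y b
  proof -
    have "\<bar>frechet_derivative f (at y) b - frechet_derivative f (at z) b\<bar> \<le> real DIM('a) * M * norm (y - z)"
      using M[OF b] y S
      by (intro smooth_Lipschitz_on_convex[where S = ?S] smooth_frechet f) auto
    also have "0 \<le> M"
      using order_trans[OF abs_ge_zero M[OF b b, of z]] by simp
    then have "real DIM('a) * M * norm (y - z) \<le> real DIM('a) * M * norm h"
      using y by (intro mult_left_mono) (auto simp: dist_norm norm_minus_commute)
    finally show ?thesis .
  qed
  define g where "g y = f y - frechet_derivative f (at z) y" for y
  have lin: "linear (frechet_derivative f (at z))" by (rule smooth_linear_frechet[OF f])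
  have sm: "smooth (frechet_derivative f (at z))"
    using lin linear_conv_bounded_linear by (blast intro: smooth_linear)
  have fd: "frechet_derivative (frechet_derivative f (at z)) (at y) = frechet_derivative f (at z)" for y
    using lin linear_conv_bounded_linear
    by (metis bounded_linear_imp_has_derivative frechet_derivative_at)
  have "\<bar>g (z + h) - g z\<bar> \<le> real DIM('a) * (real DIM('a) * M * norm h) * norm (z + h - z)"
    using 1 by (intro smooth_Lipschitz_on_convex[where S = ?S])
      (auto simp: g_def[abs_def] frechet_derivative_smooth_diff[OF f sm] fd dist_norm intro!: smooth_diff f sm)
  then show ?thesis by (simp add: g_def linear_add[OF lin] mult_ac)
qed

text \<open>
  A Hahn-Banach substitute: for a near-minimizer \<open>f\<close> of the sum of squares of \<open>c i - \<psi> i f\<close>, the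
  hypothesis \<open>dom\<close> applied with the residuals as coefficients contradicts a positive infimum.
\<close>

lemma finite_moment_approx:
  fixes S :: "'a::real_vector set" and \<psi> :: "'i \<Rightarrow> 'a \<Rightarrow> real"
  assumes I: "finite I" and S: "convex S" "S \<noteq> {}"
    and lin: "\<And>i. i \<in> I \<Longrightarrow> linear (\<psi> i)"
    and bdd: "\<And>i. i \<in> I \<Longrightarrow> \<exists>M. \<forall>f\<in>S. \<bar>\<psi> i f\<bar> \<le> M"
    and dom: "\<And>a m. (\<And>f. f \<in> S \<Longrightarrow> (\<Sum>i\<in>I. a i * \<psi> i f) \<le> m) \<Longrightarrow> (\<Sum>i\<in>I. a i * c i) \<le> m"
    and \<epsilon>: "0 < \<epsilon>"
  obtains f where "f \<in> S" "\<And>i. i \<in> I \<Longrightarrow> \<bar>\<psi> i f - c i\<bar> < \<epsilon>"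
proof -
  define J where "J f = (\<Sum>i\<in>I. (c i - \<psi> i f)\<^sup>2)" for f
  have J_nonneg: "0 \<le> J f" for f unfolding J_def by (intro sum_nonneg) simp
  define d where "d = (INF f\<in>S. J f)"
  have d_le: "d \<le> J f" if "f \<in> S" for f
    unfolding d_def using that J_nonneg by (intro cINF_lower bdd_belowI2) auto
  have "\<exists>f\<in>S. J f < \<epsilon>\<^sup>2"
  proof (rule ccontr)
    assume "\<not> (\<exists>f\<in>S. J f < \<epsilon>\<^sup>2)"
    then have "\<epsilon>\<^sup>2 \<le> d" unfolding d_def using S(2) by (intro cINF_greatest) (auto simp: not_less)
    then have d: "0 < d" using \<epsilon> by (meson less_le_trans zero_less_power)
    obtain M where M: "\<And>i f. i \<in> I \<Longrightarrow> f \<in> S \<Longrightarrow> \<bar>\<psi> i f\<bar> \<le> M i" using bdd by metis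
    \<comment> \<open>\<open>L\<close> bounds the quadratic coefficient of \<open>J\<close> along
      segments in \<open>S\<close>; adding \<open>d\<close> makes it positive and later gives
      \<open>t \<le> 1\<close>.\<close>
    define L where "L = (\<Sum>i\<in>I. (2 * M i)\<^sup>2) + d"
    have L: "0 < L" "d \<le> L" using d unfolding L_def by (auto intro!: add_nonneg_pos sum_nonneg)
    have Q: "(\<Sum>i\<in>I. (\<psi> i (g - f))\<^sup>2) \<le> L" if "f \<in> S" "g \<in> S" for f g
    proof -
      have "(\<psi> i (g - f))\<^sup>2 \<le> (2 * M i)\<^sup>2" if "i \<in> I" for i
      proof -
        have "\<bar>\<psi> i (g - f)\<bar> \<le> \<bar>2 * M i\<bar>"
          using M[OF that \<open>f \<in> S\<close>] M[OF that \<open>g \<in> S\<close>] by (simp add: linear_diff[OF lin[OF that]])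
        then show ?thesis by (simp add: abs_le_square_iff)
      qed
      then show ?thesis unfolding L_def using d by (intro add_increasing2 sum_mono) auto
    qed
    \<comment> \<open>With this step length the quadratic term \<open>t\<^sup>2 * L\<close> equals
      \<open>t * d\<close>. The excess over the infimum is kept below \<open>t * d / 2\<close>, so
      that dividing by \<open>2 * t\<close> leaves \<open>3 / 4 * d\<close>, strictly less than
      \<open>d\<close>.\<close>
    define t where "t = d / L"
    have t: "0 < t" "t \<le> 1" "t * L = d" using d L by (auto simp: t_def)
    have "\<exists>f\<in>S. J f < d + t * d / 2"
      using cInf_lessD[of "J ` S" "d + t * d / 2"] S(2) d t unfolding d_def by auto
    then obtain f where f: "f \<in> S" "J f < d + t * d / 2" by blast
    define a where "a i = c i - \<psi> i f" for i
    \<comment> \<open>Near-minimality bounds the slope of \<open>J\<close> from \<open>f\<close>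
      towards every \<open>g\<close>. In terms of the residuals this is the premise of
      \<open>dom\<close>, whose conclusion amounts to \<open>J f \<le> 3 / 4 * d\<close>.\<close>
    have "(\<Sum>i\<in>I. a i * c i) \<le> (\<Sum>i\<in>I. a i * \<psi> i f) + 3 / 4 * d"
    proof (rule dom)
      fix g assume g: "g \<in> S"
      define p where "p = (\<Sum>i\<in>I. a i * \<psi> i (g - f))"
      have "f + t *\<^sub>R (g - f) = (1 - t) *\<^sub>R f + t *\<^sub>R g" by (simp add: algebra_simps)
      then have "f + t *\<^sub>R (g - f) \<in> S" using S(1) f(1) g t convexD_alt by (metis less_imp_le)
      then have "d \<le> J (f + t *\<^sub>R (g - f))" by (rule d_le)
      also have "\<dots> = (\<Sum>i\<in>I. (a i - t * \<psi> i (g - f))\<^sup>2)"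
        unfolding J_def a_def by (intro sum.cong) (simp_all add: linear_add[OF lin] linear_cmul[OF lin] diff_diff_eq)
      also have "\<dots> = J f - 2 * t * p + t\<^sup>2 * (\<Sum>i\<in>I. (\<psi> i (g - f))\<^sup>2)"
        unfolding J_def a_def[symmetric] p_def sum_distrib_left sum_subtractf[symmetric] sum.distrib[symmetric]
        by (intro sum.cong) (simp_all add: power2_eq_square algebra_simps)
      also have "\<dots> \<le> d + t * d / 2 - 2 * t * p + t\<^sup>2 * L"
        using f(2) Q[OF f(1) g] t(1) by (intro add_mono diff_mono mult_left_mono) auto
      also have "t\<^sup>2 * L = t * d" using t(3) by (simp add: power2_eq_square)
      finally have "t * (2 * p) \<le> t * (3 / 2 * d)" by (simp add: algebra_simps)
      then have "p \<le> 3 / 4 * d" using t(1) by simp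
      moreover have "p = (\<Sum>i\<in>I. a i * \<psi> i g) - (\<Sum>i\<in>I. a i * \<psi> i f)"
        unfolding p_def sum_subtractf[symmetric]
        by (intro sum.cong) (simp_all add: linear_diff[OF lin] algebra_simps)
      ultimately show "(\<Sum>i\<in>I. a i * \<psi> i g) \<le> (\<Sum>i\<in>I. a i * \<psi> i f) + 3 / 4 * d" by simp
    qed
    moreover have "(\<Sum>i\<in>I. a i * c i) - (\<Sum>i\<in>I. a i * \<psi> i f) = J f"
      unfolding J_def a_def sum_subtractf[symmetric] by (simp add: power2_eq_square algebra_simps)
    ultimately have "J f \<le> 3 / 4 * d" by simp
    then show False using d_le[OF f(1)] d by simp
  qed
  then obtain f where f: "f \<in> S" "J f < \<epsilon>\<^sup>2" by blast
  have "\<bar>\<psi> i f - c i\<bar> < \<epsilon>" if "i \<in> I" for i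
  proof -
    have "(c i - \<psi> i f)\<^sup>2 \<le> J f" unfolding J_def using I that by (intro member_le_sum) auto
    then have "(\<psi> i f - c i)\<^sup>2 < \<epsilon>\<^sup>2" using f(2) by (simp add: power2_commute)
    then show ?thesis using \<epsilon> by (intro power2_less_imp_less[of "\<bar>\<psi> i f - c i\<bar>"]) auto
  qed
  then show thesis using that f(1) by blast
qed

section \<open>Reflexivity\<close>

lemma tvs_bounded_Ck_seminorm:
  fixes B :: "('d::finite, 'n::finite) symfun set"
  assumes B: "tvs_bounded B" and K: "compact K" "K \<noteq> {}"
  shows "\<exists>M. \<forall>f\<in>B. Ck_seminorm K n (apply_symfun f) \<le> M"
proof -
  let ?U = "{g :: ('d, 'n) symfun. Ck_seminorm K n (apply_symfun (g - 0)) < 1}"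
  have "open ?U" by (intro open_Ck_ball K) simp
  moreover have "0 \<in> ?U" using Ck_seminorm_symfun_zero[OF K] by simp
  ultimately have "\<exists>r>0. \<forall>s\<ge>r. B \<subseteq> (\<lambda>x. s *\<^sub>R x) ` ?U"
    using B unfolding tvs_bounded_def by blast
  then obtain r where r: "r > 0" "B \<subseteq> (\<lambda>x. r *\<^sub>R x) ` ?U" by blast
  have "Ck_seminorm K n (apply_symfun f) \<le> r" if "f \<in> B" for f
  proof -
    from that r(2) obtain g where g: "f = r *\<^sub>R g" "g \<in> ?U" by blast
    have "Ck_seminorm K n (apply_symfun f) \<le> \<bar>r\<bar> * Ck_seminorm K n (apply_symfun g)"
      unfolding g(1) by (rule Ck_seminorm_symfun_scaleR[OF K])
    also have "\<dots> \<le> \<bar>r\<bar> * 1" using g(2) by (intro mult_left_mono) auto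
    finally show ?thesis using r(1) by simp
  qed
  then show ?thesis by blast
qed

lemma Ck_sum: "(\<And>i. i \<in> A \<Longrightarrow> Ck n (f i)) \<Longrightarrow> Ck n (\<lambda>x. \<Sum>i\<in>A. f i x)"
  by (induction A rule: infinite_finite_induct) (simp_all add: Ck_add)

text \<open>
  The representing function is \<open>z \<mapsto> \<Lambda> (\<delta>\<^sub>z)\<close>. It is smooth because \<open>z \<mapsto> \<delta>\<^sub>z\<close> is smooth into the strong dual,
  Taylor remainders being uniform on bounded sets. To compare \<open>\<Lambda>\<close> with it at a given \<open>\<phi>\<close>, a single bounded
  \<open>f\<close> is made to match \<open>\<Lambda>\<close> at \<open>\<phi>\<close> and at all derivatives of order at most \<open>n\<close> of the point evaluations
  at a fine net, so that \<open>f\<close> and the representing function are close in the seminorm controlling \<open>\<phi>\<close>.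
\<close>

theorem symfun_reflexive:
  fixes \<Lambda> :: "('d::finite, 'n::finite) symfun strong_dual \<Rightarrow> real"
  assumes \<Lambda>: "linear \<Lambda>" "continuous_on UNIV \<Lambda>"
  obtains f where "\<And>\<phi>. \<Lambda> \<phi> = pairing \<phi> f"
proof -
  let ?D = "real DIM(('d, 'n) config)"
  let ?K = "\<lambda>R::nat. cball (0 :: ('d, 'n) config) (real R)"
  obtain B C where B: "tvs_bounded B" "B \<noteq> {}" and C: "0 \<le> C"
    and bound: "\<And>\<phi>. \<bar>\<Lambda> \<phi>\<bar> \<le> C * dual_seminorm B \<phi>"
    using strong_dual_functional_bound[OF \<Lambda>] by blast
  have K: "compact (?K R)" "?K R \<noteq> {}" for R by auto
  have "\<exists>M. \<forall>f\<in>B. Ck_seminorm (?K R) n (apply_symfun f) \<le> M" for R n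
    by (rule tvs_bounded_Ck_seminorm[OF B(1) K])
  then obtain M where M: "\<And>R n f. f \<in> B \<Longrightarrow> Ck_seminorm (?K R) n (apply_symfun f) \<le> M R n"
    by metis
  define N where "N R n = C * M R n" for R n
  have N: "0 \<le> N R n" for R n
  proof -
    obtain f where "f \<in> B" using B(2) by blast
    then have "0 \<le> M R n" using M order_trans[OF Ck_seminorm_nonneg[OF smooth_symfun K]] by blast
    then show ?thesis using C by (simp add: N_def)
  qed
  \<comment> \<open>\<open>S\<close> replaces the closed convex hull of \<open>C *\<^sub>R B\<close>: convex, bounded, and norming for \<open>\<Lambda>\<close> (see \<open>dom\<close>).\<close>
  define S where "S = {f :: ('d, 'n) symfun. \<forall>R n. Ck_seminorm (?K R) n (apply_symfun f) \<le> N R n}"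
  have S_zero: "0 \<in> S" unfolding S_def using N Ck_seminorm_symfun_zero[OF K] by simp
  have S_scale: "c *\<^sub>R f \<in> S" if "f \<in> S" "\<bar>c\<bar> = 1" for c f
    unfolding S_def
  proof (intro CollectI allI)
    fix R n
    show "Ck_seminorm (?K R) n (apply_symfun (c *\<^sub>R f)) \<le> N R n"
      using Ck_seminorm_symfun_scaleR[OF K, of R n c f] that by (auto simp: S_def intro: order_trans)
  qed
  have S_B: "C *\<^sub>R f \<in> S" if "f \<in> B" for f
    unfolding S_def
  proof (intro CollectI allI)
    fix R n
    have "Ck_seminorm (?K R) n (apply_symfun (C *\<^sub>R f)) \<le> C * Ck_seminorm (?K R) n (apply_symfun f)"
      using Ck_seminorm_symfun_scaleR[OF K, of R n C f] C by simp
    also have "\<dots> \<le> N R n" unfolding N_def using C M[OF that] by (intro mult_left_mono)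
    finally show "Ck_seminorm (?K R) n (apply_symfun (C *\<^sub>R f)) \<le> N R n" .
  qed
  have S_convex: "convex S"
    unfolding convex_def S_def
  proof (intro ballI allI impI CollectI)
    fix f g :: "('d, 'n) symfun" and u v :: real and R n
    assume f: "f \<in> {f. \<forall>R n. Ck_seminorm (?K R) n (apply_symfun f) \<le> N R n}"
      and g: "g \<in> {f. \<forall>R n. Ck_seminorm (?K R) n (apply_symfun f) \<le> N R n}"
      and u: "0 \<le> u" and v: "0 \<le> v" and uv: "u + v = 1"
    have "Ck_seminorm (?K R) n (apply_symfun (u *\<^sub>R f + v *\<^sub>R g)) \<le>
        Ck_seminorm (?K R) n (apply_symfun (u *\<^sub>R f)) + Ck_seminorm (?K R) n (apply_symfun (v *\<^sub>R g))"
      by (rule Ck_seminorm_symfun_add[OF K])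
    also have "\<dots> \<le> u * Ck_seminorm (?K R) n (apply_symfun f) + v * Ck_seminorm (?K R) n (apply_symfun g)"
      using Ck_seminorm_symfun_scaleR[OF K, of R n u f] Ck_seminorm_symfun_scaleR[OF K, of R n v g] u v
      by (intro add_mono) auto
    also have "\<dots> \<le> u * N R n + v * N R n"
      using f g u v by (intro add_mono mult_left_mono) auto
    also have "\<dots> = N R n" using uv by (metis distrib_right mult_1)
    finally show "Ck_seminorm (?K R) n (apply_symfun (u *\<^sub>R f + v *\<^sub>R g)) \<le> N R n" .
  qed
  \<comment> \<open>If \<open>C\<close> is 0 then so is the functional, and \<open>S_zero\<close>
    makes \<open>m\<close> nonnegative; otherwise scaling by \<open>C\<close> moves \<open>B\<close>
    into \<open>S\<close>.\<close>
  have dom: "\<bar>\<Lambda> \<phi>\<bar> \<le> m" if m: "\<And>f. f \<in> S \<Longrightarrow> \<bar>pairing \<phi> f\<bar> \<le> m" for \<phi> m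
  proof (cases "C = 0")
    case True
    then show ?thesis using bound[of \<phi>] m[OF S_zero] by simp
  next
    case False
    then have "C * \<bar>pairing \<phi> f\<bar> \<le> m" if "f \<in> B" for f
      using m[OF S_B[OF that]] C by (simp add: abs_mult)
    then have "dual_seminorm B \<phi> \<le> m / C"
      using False C by (intro dual_seminorm_least B) (simp add: field_simps)
    then show ?thesis using bound[of \<phi>] False C by (simp add: field_simps)
  qed
  have S_partials: "\<bar>partials es (apply_symfun f) z\<bar> \<le> N R n"
    if "f \<in> S" "set es \<subseteq> Basis" "length es \<le> n" "norm z \<le> real R" for f es z R n
    using partials_le_Ck_seminorm[OF smooth_symfun K(1) that(2,3), of z R f] that(1,4)
    by (auto simp: S_def intro: order_trans)

  define G where "G es z = \<Lambda> (deriv_at es z)" for es and z :: "('d, 'n) config"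
  \<comment> \<open>\<open>dom\<close> transfers estimates from \<open>S\<close> to the candidate,
    whose derivatives, once identified with \<open>G es\<close>, obey the same bounds as those of
    the members of \<open>S\<close>.\<close>
  have G_bound: "\<bar>G es z\<bar> \<le> N R n"
    if "set es \<subseteq> Basis" "length es \<le> n" "norm z \<le> real R" for es z R n
    unfolding G_def using that by (intro dom) (simp add: pairing_deriv_at S_partials)
  have G_deriv: "(G es has_derivative (\<lambda>h. \<Sum>b\<in>Basis. (h \<bullet> b) * G (b # es) z)) (at z)"
    if es: "set es \<subseteq> Basis" for es z
  proof -
    \<comment> \<open>The remainder estimate inspects the unit ball around \<open>z\<close>, hence
      the margin 1; it takes two further derivatives, hence the order in \<open>?N\<close>.\<close>
    obtain R :: nat where R: "norm z + 1 \<le> real R" using real_arch_simple by blast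
    let ?N = "N R (Suc (Suc (length es)))"
    show ?thesis
    proof (rule has_derivativeI_sandwich[of 1])
      have "linear (\<lambda>h. \<Sum>b\<in>Basis. (h \<bullet> b) * G (b # es) z)"
        by (intro linearI) (simp_all add: inner_add_left sum.distrib algebra_simps sum_distrib_left)
      then show "bounded_linear (\<lambda>h. \<Sum>b\<in>Basis. (h \<bullet> b) * G (b # es) z)"
        by (simp add: linear_conv_bounded_linear)
      show "((\<lambda>y. ?D * (?D * ?N) * norm (y - z)) \<longlongrightarrow> 0) (at z)"
        by (intro tendsto_mult_right_zero tendsto_norm_zero LIM_zero tendsto_ident_at)
      fix y assume y: "y \<noteq> z" "dist y z < 1"
      \<comment> \<open>The Taylor remainder of the evaluation, as a functional: it is quadratically
        small uniformly on \<open>S\<close>, so by \<open>dom\<close> its image under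
        \<open>\<Lambda>\<close> is too.\<close>
      let ?\<psi> = "deriv_at es y - deriv_at es z - (\<Sum>b\<in>Basis. ((y - z) \<bullet> b) *\<^sub>R deriv_at (b # es) z)"
      have "\<bar>\<Lambda> ?\<psi>\<bar> \<le> ?D * (?D * ?N) * norm (y - z) * norm (y - z)"
      proof (rule dom)
        fix f assume f: "f \<in> S"
        have eq: "pairing ?\<psi> f = partials es (apply_symfun f) (z + (y - z)) - partials es (apply_symfun f) z
            - frechet_derivative (partials es (apply_symfun f)) (at z) (y - z)"
          unfolding frechet_derivative_Basis[OF smooth_partials[OF smooth_symfun], of es f z "y - z"]
          using es by (simp add: pairing_deriv_at pairing_sum)
        have partials2: "\<bar>partials [c, b] (partials es (apply_symfun f)) w\<bar> \<le> ?N"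
          if "b \<in> Basis" "c \<in> Basis" "w \<in> cball z 1" for b c w
        proof -
          have "norm w \<le> real R"
            using that(3) R norm_triangle_ineq2[of w z] by (simp add: dist_norm norm_minus_commute)
          then show ?thesis using S_partials[OF f, of "c # b # es" _ w R] that es by simp
        qed
        show "\<bar>pairing ?\<psi> f\<bar> \<le> ?D * (?D * ?N) * norm (y - z) * norm (y - z)"
          unfolding eq
        proof (rule smooth_Taylor_bound[OF smooth_partials[OF smooth_symfun] partials2])
          show "norm (y - z) \<le> 1" using y(2) by (simp add: dist_norm)
        qed
      qed
      moreover have "\<Lambda> ?\<psi> = G es y - G es z - (\<Sum>b\<in>Basis. ((y - z) \<bullet> b) * G (b # es) z)"
        by (simp add: G_def linear_diff[OF \<Lambda>(1)] linear_sum[OF \<Lambda>(1)] linear_cmul[OF \<Lambda>(1)])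
      ultimately show "norm (G es y - G es z - (\<Sum>b\<in>Basis. ((y - z) \<bullet> b) * G (b # es) z)) / norm (y - z)
          \<le> ?D * (?D * ?N) * norm (y - z)"
        using y(1) by (simp add: pos_divide_le_eq)
    qed simp
  qed
  have G_frechet: "frechet_derivative (G es) (at z) e = (\<Sum>b\<in>Basis. (e \<bullet> b) * G (b # es) z)"
    if "set es \<subseteq> Basis" for es z e
    by (rule fun_cong[OF frechet_derivative_at[OF G_deriv[OF that], symmetric]])
  have G_Ck: "Ck n (G es)" if "set es \<subseteq> Basis" for n es
    using that
  proof (induction n arbitrary: es)
    case 0
    then show ?case
      using G_deriv by (auto intro!: continuous_at_imp_continuous_on has_derivative_continuous)
  next
    case (Suc n)
    have "Ck n (\<lambda>z. frechet_derivative (G es) (at z) e)" for e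
      unfolding G_frechet[OF Suc.prems]
      using Suc by (intro Ck_sum Ck_mult Ck_const) auto
    moreover have "G es differentiable at z" for z
      using G_deriv[OF Suc.prems] by (auto simp: differentiable_def)
    ultimately show ?case by simp
  qed
  have G_partials: "partials es (G []) = G es" if "set es \<subseteq> Basis" for es
    using that
  proof (induction es)
    case (Cons e es)
    have "partials (e # es) (G []) z = G (e # es) z" for z
    proof -
      have "partials (e # es) (G []) z = (\<Sum>b\<in>Basis. (e \<bullet> b) * G (b # es) z)"
        using Cons G_frechet[of es z e] by simp
      also have "\<dots> = (\<Sum>b\<in>Basis. if b = e then G (b # es) z else 0)"
        using Cons.prems by (intro sum.cong) (auto simp: inner_Basis)
      also have "\<dots> = G (e # es) z" using Cons.prems by simp
      finally show ?thesis .
    qed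
    then show ?case by (rule ext)
  qed simp
  define f\<^sub>0 where "f\<^sub>0 = Abs_symfun (G [])"
  have "G [] (permute p z) = G [] z" if "bij p" for p z
  proof -
    have "deriv_at [] (permute p z) = deriv_at [] z"
      using symmetric_symfun[unfolded symmetric_def, rule_format, OF that]
      by (intro pairing_eqI) (simp add: pairing_deriv_at)
    then show ?thesis by (simp add: G_def)
  qed
  then have apply_f\<^sub>0: "apply_symfun f\<^sub>0 = G []"
    unfolding f\<^sub>0_def using G_Ck[of "[]"]
    by (intro Abs_symfun_inverse) (simp add: smooth_def symmetric_def)

  have "\<Lambda> \<phi> = pairing \<phi> f\<^sub>0" for \<phi>
  proof (rule ccontr)
    assume neq: "\<Lambda> \<phi> \<noteq> pairing \<phi> f\<^sub>0"
    obtain R\<^sub>0 n C' where R\<^sub>0: "0 < R\<^sub>0" "0 \<le> C'"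
      "\<And>f. \<bar>pairing \<phi> f\<bar> \<le> C' * Ck_seminorm (cball 0 R\<^sub>0) n (apply_symfun f)"
      by (rule pairing_symfun_bound[of \<phi>]) blast
    obtain R :: nat where R: "R\<^sub>0 \<le> real R" using real_arch_simple by blast
    have bound\<phi>: "\<bar>pairing \<phi> f\<bar> \<le> C' * Ck_seminorm (?K R) n (apply_symfun f)" for f
    proof -
      have "Ck_seminorm (cball 0 R\<^sub>0) n (apply_symfun f) \<le> Ck_seminorm (?K R) n (apply_symfun f)"
        using R R\<^sub>0(1) by (intro Ck_seminorm_mono) auto
      then show ?thesis using R\<^sub>0(2) R\<^sub>0(3)[of f] by (meson mult_left_mono order_trans)
    qed
    \<comment> \<open>The final error is below \<open>\<epsilon> * (1 + 2 * C')\<close>: one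
      \<open>\<epsilon>\<close> from the value at \<open>\<phi>\<close>, the rest from the seminorm
      of \<open>f - f\<^sub>0\<close>. This is set to half the discrepancy.\<close>
    define \<epsilon> where "\<epsilon> = \<bar>\<Lambda> \<phi> - pairing \<phi> f\<^sub>0\<bar> / (2 * (1 + 2 * C'))"
    have \<epsilon>: "0 < \<epsilon>" using neq R\<^sub>0(2) by (simp add: \<epsilon>_def)
    \<comment> \<open>Mesh at which the derivatives up to order \<open>n\<close> of
      \<open>f - f\<^sub>0\<close> change by at most \<open>\<epsilon>\<close>; each of the two
      functions contributes \<open>N R (Suc n)\<close>, and the summand 1 keeps the divisor
      positive.\<close>
    define \<delta> where "\<delta> = \<epsilon> / (?D * (2 * N R (Suc n)) + 1)"
    have pos: "0 < ?D * (2 * N R (Suc n)) + 1" using N[of R "Suc n"] by (simp add: add_nonneg_pos)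
    then have \<delta>: "0 < \<delta>" "?D * (2 * N R (Suc n)) * \<delta> \<le> \<epsilon>"
      using \<epsilon> by (auto simp: \<delta>_def field_simps)
    obtain Z where Z: "finite Z" "Z \<subseteq> ?K R" "?K R \<subseteq> (\<Union>z\<in>Z. ball z \<delta>)"
      using seq_compact_imp_totally_bounded[of "?K R"] \<delta>(1) K(1)[of R]
      by (auto simp: compact_eq_seq_compact_metric)
    let ?E = "{es. set es \<subseteq> (Basis :: ('d, 'n) config set) \<and> length es \<le> n}"
    define I where "I = insert \<phi> ((\<lambda>(es, z). deriv_at es z) ` (?E \<times> Z))"
    have "finite I" unfolding I_def using Z(1) by (simp add: finite_lists_length_le)
    obtain f where f: "f \<in> S" "\<And>\<psi>. \<psi> \<in> I \<Longrightarrow> \<bar>pairing \<psi> f - \<Lambda> \<psi>\<bar> < \<epsilon>"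
    proof (rule finite_moment_approx[of I S pairing \<Lambda> \<epsilon>])
      show "S \<noteq> {}" using S_zero by blast
      show "\<exists>M. \<forall>f\<in>S. \<bar>pairing \<psi> f\<bar> \<le> M" for \<psi> :: "('d, 'n) symfun strong_dual"
      proof -
        obtain r m c where r: "0 < r" "0 \<le> c"
          "\<And>f. \<bar>pairing \<psi> f\<bar> \<le> c * Ck_seminorm (cball 0 r) m (apply_symfun f)"
          by (rule pairing_symfun_bound[of \<psi>]) blast
        obtain q :: nat where q: "r \<le> real q" using real_arch_simple by blast
        have "\<bar>pairing \<psi> f\<bar> \<le> c * N q m" if "f \<in> S" for f
        proof -
          have "Ck_seminorm (cball 0 r) m (apply_symfun f) \<le> Ck_seminorm (?K q) m (apply_symfun f)"
            using q r(1) by (intro Ck_seminorm_mono) auto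
          also have "\<dots> \<le> N q m" using that by (simp add: S_def)
          finally show ?thesis using r(2) r(3)[of f] by (meson mult_left_mono order_trans)
        qed
        then show ?thesis by blast
      qed
      fix a m assume m: "\<And>f. f \<in> S \<Longrightarrow> (\<Sum>\<psi>\<in>I. a \<psi> * pairing \<psi> f) \<le> m"
      let ?\<psi> = "\<Sum>\<psi>\<in>I. a \<psi> *\<^sub>R \<psi>"
      have *: "pairing ?\<psi> f \<le> m" if "f \<in> S" for f using m[OF that] by (simp add: pairing_sum)
      \<comment> \<open>The given bound is one-sided while \<open>dom\<close> takes a two-sided one;
        \<open>S\<close> is closed under negation.\<close>
      have "\<bar>\<Lambda> ?\<psi>\<bar> \<le> m"
      proof (rule dom)
        fix f assume "f \<in> S"
        then show "\<bar>pairing ?\<psi> f\<bar> \<le> m"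
          using *[of f] *[OF S_scale[of f "- 1"]] linear_cmul[OF linear_pairing, of ?\<psi> "- 1" f] by auto
      qed
      then show "(\<Sum>\<psi>\<in>I. a \<psi> * \<Lambda> \<psi>) \<le> m"
        by (simp add: linear_sum[OF \<Lambda>(1)] linear_cmul[OF \<Lambda>(1)])
    qed (use \<open>finite I\<close> S_convex \<epsilon> linear_pairing in auto)
    \<comment> \<open>At a net point the derivatives agree up to \<open>\<epsilon>\<close>, and
      moving from there to a nearby point of the ball costs at most another
      \<open>\<epsilon>\<close>.\<close>
    have "Ck_seminorm (?K R) n (apply_symfun (f - f\<^sub>0)) \<le> 2 * \<epsilon>"
    proof (rule Ck_seminorm_least)
      fix es x assume es: "set es \<subseteq> (Basis :: ('d, 'n) config set)" "length es \<le> n" and x: "x \<in> ?K R"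
      obtain z where z: "z \<in> Z" "x \<in> ball z \<delta>" using Z(3) x by blast
      have zK: "z \<in> ?K R" using z Z(2) by blast
      let ?g = "partials es (apply_symfun (f - f\<^sub>0))"
      have "\<bar>?g x - ?g z\<bar> \<le> ?D * (2 * N R (Suc n)) * norm (x - z)"
      proof (rule smooth_Lipschitz_on_convex[OF smooth_partials[OF smooth_symfun] convex_cball zK x])
        fix b w assume b: "b \<in> (Basis :: ('d, 'n) config set)" and w: "w \<in> ?K R"
        have "\<bar>partials (b # es) (apply_symfun f) w\<bar> \<le> N R (Suc n)"
          using S_partials[OF f(1)] es b w by (simp del: partials.simps)
        moreover have "\<bar>partials (b # es) (apply_symfun f\<^sub>0) w\<bar> \<le> N R (Suc n)"
          using G_bound G_partials es b w by (simp add: apply_f\<^sub>0 del: partials.simps)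
        ultimately have "\<bar>partials (b # es) (apply_symfun (f - f\<^sub>0)) w\<bar> \<le> 2 * N R (Suc n)"
          unfolding partials_symfun by simp
        then show "\<bar>frechet_derivative ?g (at w) b\<bar> \<le> 2 * N R (Suc n)" by simp
      qed
      also have "\<dots> \<le> ?D * (2 * N R (Suc n)) * \<delta>"
        using z(2) N[of R "Suc n"] by (intro mult_left_mono) (auto simp: dist_norm norm_minus_commute)
      also have "\<dots> \<le> \<epsilon>" by (rule \<delta>(2))
      finally have "\<bar>?g x - ?g z\<bar> \<le> \<epsilon>" .
      moreover have "\<bar>?g z\<bar> < \<epsilon>"
      proof -
        have "deriv_at es z \<in> I" using es z(1) by (auto simp: I_def intro!: image_eqI[of _ _ "(es, z)"])
        then show ?thesis
          using f(2)[of "deriv_at es z"] es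
          by (simp add: partials_symfun pairing_deriv_at apply_f\<^sub>0 G_partials G_def)
      qed
      ultimately show "\<bar>?g x\<bar> \<le> 2 * \<epsilon>" by linarith
    qed (rule K)
    then have "C' * Ck_seminorm (?K R) n (apply_symfun (f - f\<^sub>0)) \<le> C' * (2 * \<epsilon>)"
      using R\<^sub>0(2) by (rule mult_left_mono)
    then have "\<bar>pairing \<phi> f - pairing \<phi> f\<^sub>0\<bar> \<le> C' * (2 * \<epsilon>)"
      using bound\<phi>[of "f - f\<^sub>0"] by simp
    moreover have "\<bar>pairing \<phi> f - \<Lambda> \<phi>\<bar> < \<epsilon>" by (rule f(2)) (simp add: I_def)
    ultimately have "\<bar>\<Lambda> \<phi> - pairing \<phi> f\<^sub>0\<bar> < \<epsilon> * (1 + 2 * C')" by (simp add: algebra_simps)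
    also have "\<dots> = \<bar>\<Lambda> \<phi> - pairing \<phi> f\<^sub>0\<bar> / 2" using R\<^sub>0(2) by (simp add: \<epsilon>_def field_simps)
    finally show False by simp
  qed
  then show thesis by (rule that)
qed

section \<open>The Hamiltonian vector field of a linear functional\<close>

lemma partials_sum: "(\<And>i. i \<in> A \<Longrightarrow> smooth (f i)) \<Longrightarrow>
    partials es (\<lambda>x. \<Sum>i\<in>A. f i x) = (\<lambda>x. \<Sum>i\<in>A. partials es (f i) x)"
  by (induction es) (simp_all add: frechet_derivative_smooth_sum smooth_partials)

text \<open>Leibniz rule by removal of the innermost derivative: it splits the product into two
  products with a shorter word, so the number of terms doubles each time.\<close>

lemma abs_partials_mult_le:
  fixes f g :: "'a::euclidean_space \<Rightarrow> real"
  assumes "smooth f" "smooth g" "set es \<subseteq> Basis"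
    and "\<And>es'. set es' \<subseteq> Basis \<Longrightarrow> length es' \<le> length es \<Longrightarrow> \<bar>partials es' f x\<bar> \<le> A"
    and "\<And>es'. set es' \<subseteq> Basis \<Longrightarrow> length es' \<le> length es \<Longrightarrow> \<bar>partials es' g x\<bar> \<le> B"
  shows "\<bar>partials es (\<lambda>z. f z * g z) x\<bar> \<le> 2 ^ length es * A * B"
  using assms
proof (induction es arbitrary: f g rule: rev_induct)
  case Nil
  have "\<bar>f x\<bar> \<le> A" "\<bar>g x\<bar> \<le> B" using Nil.prems(4,5)[of "[]"] by simp_all
  then show ?case by (simp add: abs_mult mult_mono')
next
  case (snoc e es)
  have e: "e \<in> Basis" and es: "set es \<subseteq> Basis" using snoc.prems(3) by auto
  let ?f' = "\<lambda>z. frechet_derivative f (at z) e" and ?g' = "\<lambda>z. frechet_derivative g (at z) e"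
  have sm: "smooth ?f'" "smooth ?g'" using snoc.prems by (auto intro: smooth_frechet)
  have f': "\<bar>partials es' ?f' x\<bar> \<le> A" if "set es' \<subseteq> Basis" "length es' \<le> length es" for es'
    using snoc.prems(4)[of "es' @ [e]"] that e by (simp add: partials_snoc)
  have g': "\<bar>partials es' ?g' x\<bar> \<le> B" if "set es' \<subseteq> Basis" "length es' \<le> length es" for es'
    using snoc.prems(5)[of "es' @ [e]"] that e by (simp add: partials_snoc)
  have "partials (es @ [e]) (\<lambda>z. f z * g z) x =
      partials es (\<lambda>z. f z * ?g' z) x + partials es (\<lambda>z. ?f' z * g z) x"
    using snoc.prems(1,2) sm
    by (simp add: partials_snoc frechet_derivative_smooth_mult partials_add smooth_mult)
  moreover have "\<bar>partials es (\<lambda>z. f z * ?g' z) x\<bar> \<le> 2 ^ length es * A * B"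
    by (rule snoc.IH) (use snoc.prems sm es g' in simp_all)
  moreover have "\<bar>partials es (\<lambda>z. ?f' z * g z) x\<bar> \<le> 2 ^ length es * A * B"
    by (rule snoc.IH) (use snoc.prems sm es f' in simp_all)
  ultimately show ?case by simp
qed

lemma basis_in_Basis: "basis_x i k \<in> Basis" "basis_v i k \<in> Basis"
  by (auto simp: basis_x_def basis_v_def axis_in_Basis_iff Basis_prod_def inner_axis axis_eq_axis)

lemma apply_lie_bracket:
  "apply_symfun (lie_bracket f g) z = real CARD('n) * (\<Sum>i\<in>UNIV. \<Sum>k\<in>UNIV.
     frechet_derivative (apply_symfun f) (at z) (basis_x i k) * frechet_derivative (apply_symfun g) (at z) (basis_v i k)
     - frechet_derivative (apply_symfun f) (at z) (basis_v i k) * frechet_derivative (apply_symfun g) (at z) (basis_x i k))"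
  for f g :: "('d::finite, 'n::finite) symfun"
  by (simp add: lie_bracket.rep_eq grad_x_def grad_v_def inner_vec_def sum_subtractf)

lemma linear_lie_bracket: "linear (\<lambda>f. lie_bracket f h)"
  by (intro linearI symfun_eqI)
    (simp_all add: apply_lie_bracket plus_symfun.rep_eq scaleR_symfun.rep_eq
      frechet_derivative_smooth_add frechet_derivative_smooth_cmult
      sum_subtractf sum.distrib algebra_simps flip: sum_distrib_left)

text \<open>The bracket costs one derivative of \<open>f\<close>; the fixed \<open>h\<close> enters
  only through the constant.\<close>

lemma Ck_seminorm_lie_bracket:
  fixes h :: "('d::finite, 'n::finite) symfun"
  assumes K: "compact K" "K \<noteq> {}"
  obtains C where "0 \<le> C" "\<And>f. Ck_seminorm K n (apply_symfun (lie_bracket f h)) \<le> C * Ck_seminorm K (Suc n) (apply_symfun f)"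
proof
  let ?p = "\<lambda>f. Ck_seminorm K (Suc n) (apply_symfun f)"
  \<comment> \<open>Two products for each particle and coordinate, with \<open>2 ^ n\<close> Leibniz
    terms in each product.\<close>
  let ?c = "2 * (2 ^ n * ?p h)"
  let ?C = "real CARD('n) * (\<Sum>i\<in>(UNIV::'n set). \<Sum>k\<in>(UNIV::'d set). ?c)"
  have p: "0 \<le> ?p f" for f :: "('d, 'n) symfun" by (rule Ck_seminorm_nonneg[OF smooth_symfun K])
  then show "0 \<le> ?C" by (intro mult_nonneg_nonneg sum_nonneg) auto
  fix f :: "('d, 'n) symfun"
  let ?D = "\<lambda>f e z. frechet_derivative (apply_symfun f) (at z) e"
  show "Ck_seminorm K n (apply_symfun (lie_bracket f h)) \<le> ?C * ?p f"
  proof (rule Ck_seminorm_least[OF K(2)])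
    fix es x assume es: "set es \<subseteq> (Basis :: ('d, 'n) config set)" "length es \<le> n" and x: "x \<in> K"
    have deriv_le: "\<bar>partials es' (?D f e) x\<bar> \<le> ?p f"
      if "set es' \<subseteq> Basis" "length es' \<le> length es" "e \<in> Basis" for es' e and f :: "('d, 'n) symfun"
      using partials_le_Ck_seminorm[OF smooth_symfun K(1), of "es' @ [e]" "Suc n" x f] that es x
      by (simp add: partials_snoc)
    have term_le: "\<bar>partials es (\<lambda>z. ?D f e z * ?D h e' z) x\<bar> \<le> 2 ^ n * ?p h * ?p f"
      if "e \<in> Basis" "e' \<in> Basis" for e e'
    proof -
      have "\<bar>partials es (\<lambda>z. ?D f e z * ?D h e' z) x\<bar> \<le> 2 ^ length es * ?p f * ?p h"
        using that es by (intro abs_partials_mult_le smooth_frechet smooth_symfun deriv_le)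
      also have "\<dots> \<le> 2 ^ n * ?p f * ?p h"
        using es p[of f] p[of h] by (intro mult_right_mono power_increasing) auto
      finally show ?thesis by (simp add: mult_ac)
    qed
    have sm: "smooth (\<lambda>z. ?D f e z * ?D h e' z)" for e e'
      by (intro smooth_mult smooth_frechet smooth_symfun)
    have "partials es (apply_symfun (lie_bracket f h)) x = real CARD('n) *
        (\<Sum>i\<in>UNIV. \<Sum>k\<in>UNIV. partials es (\<lambda>z. ?D f (basis_x i k) z * ?D h (basis_v i k) z) x
          - partials es (\<lambda>z. ?D f (basis_v i k) z * ?D h (basis_x i k) z) x)"
      unfolding apply_lie_bracket[abs_def]
      by (simp add: partials_cmult partials_sum partials_diff sm smooth_sum smooth_diff)
    also have "\<bar>\<dots>\<bar> \<le> real CARD('n) * (\<Sum>i\<in>(UNIV::'n set). \<Sum>k\<in>(UNIV::'d set). ?c * ?p f)"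
    proof -
      have "\<bar>partials es (\<lambda>z. ?D f (basis_x i k) z * ?D h (basis_v i k) z) x
          - partials es (\<lambda>z. ?D f (basis_v i k) z * ?D h (basis_x i k) z) x\<bar> \<le> ?c * ?p f" for i k
        using term_le[OF basis_in_Basis(1,2), of i k i k] term_le[OF basis_in_Basis(2,1), of i k i k]
        by (simp add: mult_ac)
      then show ?thesis
        unfolding abs_mult abs_of_nat
        by (intro mult_left_mono order_trans[OF sum_abs] sum_mono) auto
    qed
    also have "\<dots> = ?C * ?p f" by (simp add: sum_distrib_right)
    finally show "\<bar>partials es (apply_symfun (lie_bracket f h)) x\<bar> \<le> ?C * ?p f" .
  qed
qed

lemma continuous_lie_bracket: "continuous_on UNIV (\<lambda>f. lie_bracket f h)"
proof (rule continuous_on_UNIV_nhdI)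
  fix f V assume "open V" "lie_bracket f h \<in> V"
  from open_symfun_ball[OF this] obtain K n \<epsilon> where K: "compact K" "K \<noteq> {}" "0 < \<epsilon>"
    and V: "{g. Ck_seminorm K n (apply_symfun (g - lie_bracket f h)) < \<epsilon>} \<subseteq> V" by blast
  obtain C where C: "0 \<le> C"
    "\<And>f. Ck_seminorm K n (apply_symfun (lie_bracket f h)) \<le> C * Ck_seminorm K (Suc n) (apply_symfun f)"
    by (rule Ck_seminorm_lie_bracket[OF K(1,2), of n h]) blast
  let ?U = "{g. Ck_seminorm K (Suc n) (apply_symfun (g - f)) < \<epsilon> / (C + 1)}"
  have "lie_bracket g h \<in> V" if "g \<in> ?U" for g
  proof -
    have "Ck_seminorm K n (apply_symfun (lie_bracket g h - lie_bracket f h)) \<le>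
        C * Ck_seminorm K (Suc n) (apply_symfun (g - f))"
      using C(2)[of "g - f"] linear_diff[OF linear_lie_bracket, of g f h] by simp
    also have "\<dots> \<le> (C + 1) * Ck_seminorm K (Suc n) (apply_symfun (g - f))"
      using Ck_seminorm_nonneg[OF smooth_symfun K(1,2)] by (intro mult_right_mono) auto
    also have "\<dots> < \<epsilon>" using that C(1) by (simp add: field_simps)
    finally show ?thesis using V by blast
  qed
  moreover have "open ?U" using C(1) K by (intro open_Ck_ball) auto
  moreover have "f \<in> ?U" using C(1) K Ck_seminorm_symfun_zero[OF K(1,2)] by simp
  ultimately show "\<exists>U. open U \<and> f \<in> U \<and> (\<lambda>f. lie_bracket f h) ` U \<subseteq> V" by blast
qed

lemma functional_deriv_eqI:
  assumes "\<And>\<eta>. pairing \<eta> f = gateaux UNIV F \<gamma> \<eta>"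
  shows "functional_deriv F \<gamma> = f"
  unfolding functional_deriv_def
proof (rule the_equality)
  show "\<forall>\<eta>. pairing \<eta> f = gateaux UNIV F \<gamma> \<eta>" using assms by blast
  show "g = f" if "\<forall>\<eta>. pairing \<eta> g = gateaux UNIV F \<gamma> \<eta>" for g
    using assms that by (intro symfun_eqI_pairing) simp
qed

text \<open>Reflexivity is applied here: the derivative is linear and continuous in its direction,
  so the definite description denotes an actual representer.\<close>

lemma pairing_functional_deriv:
  assumes "gateaux_smooth UNIV F"
  shows "pairing \<eta> (functional_deriv F \<gamma>) = gateaux UNIV F \<gamma> \<eta>"
proof -
  obtain f where "\<And>\<phi>. gateaux UNIV F \<gamma> \<phi> = pairing \<phi> f"
    by (rule symfun_reflexive[OF linear_gateaux[OF assms, of \<gamma>] continuous_gateaux_direction[OF assms]]) blast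
  then show ?thesis using functional_deriv_eqI[of f F \<gamma>] by simp
qed

lemma
  fixes h :: "('d::finite, 'n::finite) symfun"
  shows gateaux_smooth_pairing: "gateaux_smooth UNIV (\<lambda>\<phi>. pairing \<phi> h)"
    and gateaux_pairing: "gateaux UNIV (\<lambda>\<phi>. pairing \<phi> h) \<gamma> \<eta> = pairing \<eta> h"
  using gateaux_smooth_linear[OF Hausdorff_space_euclidean linear_pairing_left
      continuous_pairing_left[OF tvs_bounded_symfun_singleton, of h]] by blast+

text \<open>The coadjoint action of \<open>h\<close>, up to sign conventions. It is linear in the
  functional, which reduces its smoothness to \<open>gateaux_smooth_linear\<close>.\<close>

definition lie_poisson_vf :: "('d::finite, 'n::finite) symfun \<Rightarrow> ('d, 'n) symfun strong_dual \<Rightarrow> ('d, 'n) symfun strong_dual" where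
  "lie_poisson_vf h = transpose_dual (\<lambda>f. lie_bracket f h)"

lemma pairing_lie_poisson_vf: "pairing (lie_poisson_vf h \<gamma>) f = pairing \<gamma> (lie_bracket f h)"
  unfolding lie_poisson_vf_def
  by (rule pairing_transpose_dual[OF linear_lie_bracket continuous_lie_bracket])

lemma poisson_bracket_pairing:
  "poisson_bracket F (\<lambda>\<phi>. pairing \<phi> h) \<gamma> = pairing \<gamma> (lie_bracket (functional_deriv F \<gamma>) h)"
  unfolding poisson_bracket_def by (simp add: functional_deriv_eqI gateaux_pairing)

text \<open>Stated as an equivalence, this yields existence, uniqueness and the value of
  \<open>hamiltonian_vf\<close> together.\<close>

lemma is_hamiltonian_vf_pairing_iff:
  "is_hamiltonian_vf (\<lambda>\<phi>. pairing \<phi> h) X \<longleftrightarrow> X = lie_poisson_vf h"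
proof
  assume X: "is_hamiltonian_vf (\<lambda>\<phi>. pairing \<phi> h) X"
  show "X = lie_poisson_vf h"
  proof (intro ext pairing_eqI)
    fix \<gamma> f
    have "gateaux UNIV (\<lambda>\<phi>. pairing \<phi> f) \<gamma> (X \<gamma>) = poisson_bracket (\<lambda>\<phi>. pairing \<phi> f) (\<lambda>\<phi>. pairing \<phi> h) \<gamma>"
      using X gateaux_smooth_pairing unfolding is_hamiltonian_vf_def by blast
    then show "pairing (X \<gamma>) f = pairing (lie_poisson_vf h \<gamma>) f"
      by (simp add: gateaux_pairing poisson_bracket_pairing functional_deriv_eqI pairing_lie_poisson_vf)
  qed
next
  assume X: "X = lie_poisson_vf h"
  have "gateaux_smooth UNIV (lie_poisson_vf h)"
    unfolding lie_poisson_vf_def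
    by (intro gateaux_smooth_linear Hausdorff_symfun_strong_dual linear_transpose_dual
        continuous_transpose_dual linear_lie_bracket continuous_lie_bracket)
  then show "is_hamiltonian_vf (\<lambda>\<phi>. pairing \<phi> h) X"
    unfolding is_hamiltonian_vf_def X
    by (simp add: gateaux_smooth_pairing poisson_bracket_pairing pairing_lie_poisson_vf
        flip: pairing_functional_deriv)
qed

section \<open>Density of test functions\<close>

text \<open>The powers in the denominator make the family closed under differentiation up to linear
  combinations, so one induction over all \<open>k\<close> handles every derivative.\<close>

definition flat_exp :: "nat \<Rightarrow> real \<Rightarrow> real" where
  "flat_exp k x = (if 0 < x then exp (- (1 / x)) / x ^ k else 0)"

lemma flat_exp_tendsto_0: "(flat_exp k \<longlongrightarrow> 0) (at 0)"
proof -
  \<comment> \<open>Passing to the reciprocal compares a power with the exponential at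
    infinity.\<close>
  have "((\<lambda>x. inverse x ^ k / exp (inverse x)) \<longlongrightarrow> 0) (at_right (0::real))"
    by (rule filterlim_compose[OF tendsto_power_div_exp_0 filterlim_inverse_at_top_right])
  then have "(flat_exp k \<longlongrightarrow> 0) (at_right 0)"
  proof (rule Lim_transform_eventually)
    show "\<forall>\<^sub>F x in at_right 0. inverse x ^ k / exp (inverse x) = flat_exp k x"
      using eventually_at_right_less
      by eventually_elim (simp add: flat_exp_def exp_minus field_simps)
  qed
  moreover have "(flat_exp k \<longlongrightarrow> 0) (at_left 0)"
  proof (rule tendsto_eventually)
    show "\<forall>\<^sub>F x in at_left 0. flat_exp k x = 0"
      by (simp add: eventually_at_filter flat_exp_def)
  qed
  ultimately show ?thesis by (simp add: filterlim_at_split)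
qed

lemma DERIV_flat_exp:
  "(flat_exp k has_real_derivative flat_exp (Suc (Suc k)) x - real k * flat_exp (Suc k) x) (at x)"
proof -
  consider "0 < x" | "x < 0" | "x = 0" by linarith
  then show ?thesis
  proof cases
    case 1
    have "((\<lambda>x. exp (- (1 / x))) has_real_derivative exp (- (1 / x)) * (1 / x\<^sup>2)) (at x)"
      using 1 by (auto intro!: derivative_eq_intros simp: power2_eq_square)
    from DERIV_divide[OF this DERIV_pow, of k] 1
    have "((\<lambda>x. exp (- (1 / x)) / x ^ k) has_real_derivative
        (exp (- (1 / x)) * (1 / x\<^sup>2) * x ^ k - exp (- (1 / x)) * (real k * x ^ (k - Suc 0))) / (x ^ k * x ^ k)) (at x)"
      by simp
    also have "(exp (- (1 / x)) * (1 / x\<^sup>2) * x ^ k - exp (- (1 / x)) * (real k * x ^ (k - Suc 0))) / (x ^ k * x ^ k) =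
        flat_exp (Suc (Suc k)) x - real k * flat_exp (Suc k) x"
      using 1 by (cases k) (simp_all add: flat_exp_def field_simps power2_eq_square)
    finally have "((\<lambda>x. exp (- (1 / x)) / x ^ k) has_real_derivative
        flat_exp (Suc (Suc k)) x - real k * flat_exp (Suc k) x) (at x)" .
    then show ?thesis
    proof (rule has_field_derivative_transform_within_open)
      show "open {0::real<..}" "x \<in> {0<..}" using 1 by auto
    qed (simp add: flat_exp_def)
  next
    case 2
    have "((\<lambda>x. 0) has_real_derivative flat_exp (Suc (Suc k)) x - real k * flat_exp (Suc k) x) (at x)"
      using 2 by (simp add: flat_exp_def)
    then show ?thesis
    proof (rule has_field_derivative_transform_within_open)
      show "open {..<0::real}" "x \<in> {..<0}" using 2 by auto
    qed (simp add: flat_exp_def)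
  next
    case 3
    \<comment> \<open>At 0 the difference quotient is the next member of the family.\<close>
    have "((\<lambda>h. (flat_exp k (0 + h) - flat_exp k 0) / h) \<longlongrightarrow> 0) (at 0)"
      using flat_exp_tendsto_0[of "Suc k"]
    proof (rule Lim_transform_eventually)
      show "\<forall>\<^sub>F h in at 0. flat_exp (Suc k) h = (flat_exp k (0 + h) - flat_exp k 0) / h"
        by (simp add: flat_exp_def)
    qed
    then show ?thesis using 3 by (simp add: DERIV_def flat_exp_def)
  qed
qed

lemma smooth_flat_exp: "smooth (flat_exp k)"
  unfolding smooth_def
proof
  show "Ck n (flat_exp k)" for n
  proof (induction n arbitrary: k)
    case 0
    show ?case
      by (simp add: continuous_at_imp_continuous_on DERIV_isCont[OF DERIV_flat_exp])
  next
    case (Suc n)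
    have "(flat_exp k has_derivative
        (\<lambda>e. e * (flat_exp (Suc (Suc k)) x - real k * flat_exp (Suc k) x))) (at x)" for x
      using DERIV_flat_exp[of k x] by (simp add: has_field_derivative_def mult_commute_abs)
    then have "flat_exp k differentiable at x" "frechet_derivative (flat_exp k) (at x) =
        (\<lambda>e. e * (flat_exp (Suc (Suc k)) x + (- real k) * flat_exp (Suc k) x))" for x
      by (auto simp: differentiable_def frechet_derivative_at[symmetric])
    then show ?case by (simp only: Ck.simps) (intro conjI allI Ck_mult Ck_add Ck_const Suc | simp)+
  qed
qed

section \<open>Composition, reciprocals and cutoff functions\<close>

lemma Ck_compose_real:
  fixes h :: "real \<Rightarrow> real"
  shows "Ck n h \<Longrightarrow> Ck n g \<Longrightarrow> Ck n (\<lambda>x. h (g x))"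
proof (induction n arbitrary: h g)
  case 0
  then show ?case using continuous_on_compose2[of UNIV h UNIV g] by simp
next
  case (Suc n)
  then have d: "(h has_derivative frechet_derivative h (at y)) (at y)"
    "(g has_derivative frechet_derivative g (at x)) (at x)" for x y
    by (simp_all flip: frechet_derivative_works)
  have lin: "frechet_derivative h (at y) r = r * frechet_derivative h (at y) 1" for y r
    using linear_cmul[OF has_derivative_linear[OF d(1)[of y]], of r 1] by simp
  have "((\<lambda>x. h (g x)) has_derivative
      (\<lambda>e. frechet_derivative g (at x) e * frechet_derivative h (at (g x)) 1)) (at x)" for x
    using has_derivative_compose[OF d(2) d(1), of x]
    by (rule has_derivative_eq_rhs) (rule ext, rule lin)
  then have "(\<lambda>x. h (g x)) differentiable at x" "frechet_derivative (\<lambda>x. h (g x)) (at x) =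
      (\<lambda>e. frechet_derivative g (at x) e * frechet_derivative h (at (g x)) 1)" for x
    by (auto simp: differentiable_def frechet_derivative_at[symmetric])
  moreover have "Ck n (\<lambda>x. frechet_derivative g (at x) e * frechet_derivative h (at (g x)) 1)" for e
    using Suc.prems Ck_SucD[OF Suc.prems(2)] by (intro Ck_mult Suc.IH[of "\<lambda>y. frechet_derivative h (at y) 1"]) auto
  ultimately show ?case by simp
qed

lemma Ck_inverse:
  fixes g :: "'a::real_normed_vector \<Rightarrow> real"
  shows "Ck n g \<Longrightarrow> (\<And>x. g x \<noteq> 0) \<Longrightarrow> Ck n (\<lambda>x. inverse (g x))"
proof (induction n)
  case 0
  then show ?case by (auto intro: continuous_on_inverse)
next
  case (Suc n)
  then have g: "(g has_derivative frechet_derivative g (at x)) (at x)" for x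
    by (simp flip: frechet_derivative_works)
  have "((\<lambda>x. inverse (g x)) has_derivative
      (\<lambda>e. - 1 * (inverse (g x) * frechet_derivative g (at x) e * inverse (g x)))) (at x)" for x
    using Deriv.has_derivative_inverse[of g x, OF Suc.prems(2) g] by simp
  then have "(\<lambda>x. inverse (g x)) differentiable at x" "frechet_derivative (\<lambda>x. inverse (g x)) (at x) =
      (\<lambda>e. - 1 * (inverse (g x) * frechet_derivative g (at x) e * inverse (g x)))" for x
    by (auto simp: differentiable_def frechet_derivative_at[symmetric])
  moreover have "Ck n (\<lambda>x. - 1 * (inverse (g x) * frechet_derivative g (at x) e * inverse (g x)))" for e
    using Suc Ck_SucD[OF Suc.prems(1)] by (intro Ck_mult Ck_const) auto
  ultimately show ?case by simp
qed

text \<open>Smooth transition in the squared radius, from 1 up to \<open>r\<close> to 0 beyond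
  \<open>r + 1\<close>. The two arguments in the denominator sum to 1, so one of them is positive;
  dependence on \<open>z \<bullet> z\<close> alone makes the cutoff permutation invariant.\<close>

definition bump :: "real \<Rightarrow> 'a::euclidean_space \<Rightarrow> real" where
  "bump r z = flat_exp 0 (r + 1 - z \<bullet> z) * inverse (flat_exp 0 (r + 1 - z \<bullet> z) + flat_exp 0 (z \<bullet> z - r))"

lemma smooth_bump: "smooth (bump r)"
proof -
  have inner: "smooth (\<lambda>z::'a. z \<bullet> z)"
    by (subst euclidean_inner)
      (intro smooth_sum smooth_mult smooth_linear bounded_linear_inner_left)
  have flat: "smooth (\<lambda>z::'a. flat_exp 0 (g z))" if "smooth g" for g
    using that smooth_flat_exp[of 0] unfolding smooth_def by (auto intro: Ck_compose_real[of _ "flat_exp 0"])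
  have "0 < flat_exp 0 (r + 1 - s) + flat_exp 0 (s - r)" for s
    by (auto simp: flat_exp_def intro: add_pos_pos)
  then have "flat_exp 0 (r + 1 - z \<bullet> z) + flat_exp 0 (z \<bullet> z - r) \<noteq> 0" for z :: 'a
    by (metis less_irrefl)
  moreover have "smooth (\<lambda>z::'a. flat_exp 0 (r + 1 - z \<bullet> z))" "smooth (\<lambda>z::'a. flat_exp 0 (z \<bullet> z - r))"
    by (intro flat smooth_diff inner smooth_const)+
  ultimately show ?thesis
    unfolding bump_def[abs_def] by (intro smooth_mult) (auto simp: smooth_def intro!: Ck_inverse Ck_add)
qed

lemma bump_eq_1: "z \<bullet> z \<le> r \<Longrightarrow> bump r z = 1"
  by (simp add: bump_def flat_exp_def)

lemma bump_nonzero: "bump r z \<noteq> 0 \<Longrightarrow> z \<bullet> z < r + 1"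
  by (rule ccontr) (simp add: bump_def flat_exp_def)

lemma test_function_bump_mult:
  fixes f :: "'a::euclidean_space \<Rightarrow> real"
  assumes "smooth f"
  shows "test_function (\<lambda>z. bump r z * f z)"
proof -
  have "{z. bump r z * f z \<noteq> 0} \<subseteq> cball 0 (sqrt (r + 1))"
    using bump_nonzero[of r] by (force simp: norm_eq_sqrt_inner)
  then have "bounded {z. bump r z * f z \<noteq> 0}" using bounded_cball bounded_subset by blast
  then show ?thesis
    unfolding test_function_def using assms by (simp add: smooth_mult smooth_bump)
qed

lemma inner_permute: "bij p \<Longrightarrow> permute p z \<bullet> permute p z = z \<bullet> z"
  using sum.reindex_bij_betw[of p UNIV UNIV "\<lambda>i. z $ i \<bullet> z $ i"] by (simp add: inner_vec_def permute_def)

lemma partials_zero_on_open: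
  assumes "open U" "x \<in> U" "\<And>x. x \<in> U \<Longrightarrow> f x = 0"
  shows "partials es f x = 0"
  using assms(2)
proof (induction es arbitrary: x)
  case Nil
  then show ?case using assms(3) by simp
next
  case (Cons e es)
  have "(partials es f has_derivative (\<lambda>_. 0)) (at x)"
    by (rule has_derivative_transform_within_open[OF has_derivative_const[of 0] assms(1) Cons.prems])
      (simp add: Cons.IH)
  then show ?case by (simp add: frechet_derivative_at[symmetric])
qed

text \<open>Cutting off with a radial bump preserves the permutation symmetry, so no symmetrization is needed.\<close>

lemma strong_dual_eqI_test_function:
  fixes \<phi> \<psi> :: "('d::finite, 'n::finite) symfun strong_dual"
  assumes "\<And>f. test_function (apply_symfun f) \<Longrightarrow> pairing \<phi> f = pairing \<psi> f"
  shows "\<phi> = \<psi>"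
proof (rule pairing_eqI)
  fix f :: "('d, 'n) symfun"
  obtain R n C where R: "0 < R"
    and bound: "\<And>g. \<bar>pairing (\<phi> - \<psi>) g\<bar> \<le> C * Ck_seminorm (cball 0 R) n (apply_symfun g)"
    by (rule pairing_symfun_bound[of "\<phi> - \<psi>"]) blast
  \<comment> \<open>\<open>bump\<close> takes a squared radius. The margin 1 makes
    \<open>f - g\<close> vanish on an open set containing the ball of the seminorm, hence together
    with all its derivatives.\<close>
  define g where "g = Abs_symfun (\<lambda>z. bump ((R + 1)\<^sup>2) z * apply_symfun f z)"
  have "symmetric (\<lambda>z. bump ((R + 1)\<^sup>2) z * apply_symfun f z)"
    using symmetric_symfun[of f] by (simp add: symmetric_def bump_def inner_permute)
  then have g: "apply_symfun g = (\<lambda>z. bump ((R + 1)\<^sup>2) z * apply_symfun f z)"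
    unfolding g_def by (intro Abs_symfun_inverse) (simp add: smooth_mult smooth_bump)
  have g_eq: "pairing \<phi> g = pairing \<psi> g"
    by (rule assms) (simp add: g test_function_bump_mult)
  have zero: "apply_symfun (f - g) z = 0" if "z \<in> ball 0 (R + 1)" for z
  proof -
    have "z \<bullet> z \<le> (R + 1)\<^sup>2" using that R power_mono[of "norm z" "R + 1" 2] by (simp add: dot_square_norm)
    then show ?thesis by (simp add: minus_symfun.rep_eq g bump_eq_1)
  qed
  have "Ck_seminorm (cball 0 R) n (apply_symfun (f - g)) \<le> 0"
  proof (rule Ck_seminorm_least[rotated])
    fix es and x :: "('d, 'n) config" assume "x \<in> cball 0 R"
    then have "x \<in> ball 0 (R + 1)" by auto
    from partials_zero_on_open[OF open_ball this zero]
    show "\<bar>partials es (apply_symfun (f - g)) x\<bar> \<le> 0" by simp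
  qed (use R in auto)
  then have "Ck_seminorm (cball 0 R) n (apply_symfun (f - g)) = 0"
    using Ck_seminorm_nonneg[OF smooth_symfun, of "cball 0 R" n "f - g"] R by simp
  then have "pairing (\<phi> - \<psi>) (f - g) = 0" using bound[of "f - g"] by simp
  with g_eq show "pairing \<phi> f = pairing \<psi> f" by simp
qed

section \<open>The Liouville equation\<close>

lemma frechet_derivative_even:
  assumes "smooth W" "\<And>x. W (- x) = W x"
  shows "frechet_derivative W (at (- x)) e = - frechet_derivative W (at x) e"
proof -
  have "frechet_derivative W (at x) e = frechet_derivative (\<lambda>x. W (- x)) (at x) e"
    using assms(2) by simp
  also have "\<dots> = frechet_derivative W (at (- x)) (- e)"
    by (rule frechet_derivative_compose_bounded_linear[OF assms(1)])
      (intro bounded_linear_minus bounded_linear_ident)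
  also have "\<dots> = - frechet_derivative W (at (- x)) e"
    by (rule linear_neg[OF smooth_linear_frechet[OF assms(1)]])
  finally show ?thesis by simp
qed

text \<open>Oddness of the force; for \<open>x = y\<close> it shows that the diagonal terms of the
  Liouville equation vanish.\<close>

lemma grad_minus:
  assumes "smooth W" "\<And>x. W (- x) = W x"
  shows "grad W (x - y) $ k = - (grad W (y - x) $ k)"
  using frechet_derivative_even[OF assms, of "y - x"] by (simp add: grad_def)

lemma has_derivative_H_N:
  fixes z :: "('d::finite, 'n::finite) config"
  assumes "smooth W"
  shows "(H_N W has_derivative (\<lambda>e. (\<Sum>i\<in>UNIV. snd (z $ i) \<bullet> snd (e $ i))
     + (1 / real CARD('n)) * (\<Sum>(i, j)\<in>{(i, j). i \<noteq> j}.
         frechet_derivative W (at (fst (z $ i) - fst (z $ j))) (fst (e $ i) - fst (e $ j))))) (at z)"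
proof -
  have W: "((\<lambda>z :: ('d, 'n) config. W (fst (z $ i) - fst (z $ j))) has_derivative
      (\<lambda>e. frechet_derivative W (at (fst (z $ i) - fst (z $ j))) (fst (e $ i) - fst (e $ j)))) (at z)" for i j
    by (rule has_derivative_compose[OF _ smooth_has_derivative[OF assms]])
      (intro bounded_linear_imp_has_derivative bounded_linear_sub bounded_linear_fst_comp bounded_linear_vec_nth)
  have v: "((\<lambda>z :: ('d, 'n) config. snd (z $ i)) has_derivative (\<lambda>e. snd (e $ i))) (at z)" for i
    by (intro bounded_linear_imp_has_derivative bounded_linear_snd_comp bounded_linear_vec_nth)
  have kin: "((\<lambda>z :: ('d, 'n) config. \<Sum>i\<in>UNIV. snd (z $ i) \<bullet> snd (z $ i)) has_derivative
      (\<lambda>e. \<Sum>i\<in>UNIV. snd (z $ i) \<bullet> snd (e $ i) + snd (e $ i) \<bullet> snd (z $ i))) (at z)"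
    by (intro has_derivative_sum has_derivative_inner v)
  have pot: "((\<lambda>z :: ('d, 'n) config. \<Sum>x\<in>{x. fst x \<noteq> snd x}. W (fst (z $ fst x) - fst (z $ snd x))) has_derivative
      (\<lambda>e. \<Sum>x\<in>{x. fst x \<noteq> snd x}. frechet_derivative W (at (fst (z $ fst x) - fst (z $ snd x)))
        (fst (e $ fst x) - fst (e $ snd x)))) (at z)"
    by (intro has_derivative_sum W)
  show ?thesis
    unfolding H_N_def[abs_def] power2_norm_eq_inner case_prod_unfold
    using has_derivative_add[OF has_derivative_mult_right[OF kin, of "1 / 2"]
        has_derivative_mult_right[OF pot, of "1 / real CARD('n)"]]
    by (rule has_derivative_eq_rhs) (simp add: inner_commute sum_distrib_left)
qed

lemma frechet_derivative_H_N_v: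
  fixes z :: "('d::finite, 'n::finite) config"
  assumes "smooth W"
  shows "frechet_derivative (H_N W) (at z) (basis_v m k) = snd (z $ m) $ k"
proof -
  have "fst (basis_v m k $ i) = 0" for i :: 'n by (simp add: basis_v_def axis_def)
  moreover have "snd (z $ i) \<bullet> snd (basis_v m k $ i) = (if i = m then snd (z $ m) $ k else 0)" for i
    by (simp add: basis_v_def axis_def[of m] inner_axis)
  ultimately show ?thesis
    unfolding fun_cong[OF frechet_derivative_at[OF has_derivative_H_N[OF assms], symmetric]]
    by (simp add: linear_0[OF smooth_linear_frechet[OF assms]] case_prod_unfold)
qed

text \<open>The position of particle \<open>m\<close> occurs in the ordered pairs (m, j) and (j, m);
  by oddness of the gradient both contribute the same, hence the factor 2.\<close>

lemma frechet_derivative_H_N_x: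
  fixes z :: "('d::finite, 'n::finite) config"
  assumes "smooth W" "\<And>x. W (- x) = W x"
  shows "frechet_derivative (H_N W) (at z) (basis_x m k) =
    2 / real CARD('n) * (\<Sum>j\<in>UNIV. grad W (fst (z $ m) - fst (z $ j)) $ k)"
proof -
  let ?w = "\<lambda>i j. grad W (fst (z $ i) - fst (z $ j)) $ k"
  let ?\<delta> = "\<lambda>i. if i = m then 1 else 0 :: real"
  have fst: "fst (basis_x m k $ i) = ?\<delta> i *\<^sub>R axis k 1" for i :: 'n
    by (simp add: basis_x_def axis_def[of m])
  have snd: "snd (basis_x m k $ i) = 0" for i :: 'n by (simp add: basis_x_def axis_def)
  have summand: "frechet_derivative W (at (fst (z $ i) - fst (z $ j))) (fst (basis_x m k $ i) - fst (basis_x m k $ j))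
      = (?\<delta> i - ?\<delta> j) * ?w i j" for i j
    unfolding fst scaleR_left_diff_distrib[symmetric] linear_cmul[OF smooth_linear_frechet[OF assms(1)]]
    by (simp add: grad_def)
  \<comment> \<open>On the diagonal the two deltas cancel, so the excluded pairs may be
    added.\<close>
  have "(\<Sum>(i, j)\<in>{(i, j). i \<noteq> j}. (?\<delta> i - ?\<delta> j) * ?w i j) = (\<Sum>(i, j)\<in>UNIV. (?\<delta> i - ?\<delta> j) * ?w i j)"
    by (rule sum.mono_neutral_left) auto
  also have "\<dots> = (\<Sum>i\<in>UNIV. \<Sum>j\<in>UNIV. (?\<delta> i - ?\<delta> j) * ?w i j)"
    by (simp add: sum.cartesian_product)
  also have "\<dots> = (\<Sum>i\<in>UNIV. \<Sum>j\<in>UNIV. ?\<delta> i * ?w i j) - (\<Sum>i\<in>UNIV. \<Sum>j\<in>UNIV. ?\<delta> j * ?w i j)"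
    by (simp add: left_diff_distrib sum_subtractf)
  also have "(\<Sum>i\<in>UNIV. \<Sum>j\<in>UNIV. ?\<delta> i * ?w i j) = (\<Sum>j\<in>UNIV. ?w m j)"
    by (subst sum.swap) (simp add: if_distrib[of "\<lambda>x. x * _"] cong: if_cong)
  also have "(\<Sum>i\<in>UNIV. \<Sum>j\<in>UNIV. ?\<delta> j * ?w i j) = (\<Sum>i\<in>UNIV. ?w i m)"
    by (simp add: if_distrib[of "\<lambda>x. x * _"] cong: if_cong)
  also have "(\<Sum>i\<in>UNIV. ?w i m) = - (\<Sum>i\<in>UNIV. ?w m i)"
    unfolding sum_negf[symmetric] by (intro sum.cong refl grad_minus assms)
  finally have "(\<Sum>(i, j)\<in>{(i, j). i \<noteq> j}. (?\<delta> i - ?\<delta> j) * ?w i j) = 2 * (\<Sum>j\<in>UNIV. ?w m j)" by simp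
  then show ?thesis
    unfolding fun_cong[OF frechet_derivative_at[OF has_derivative_H_N[OF assms(1)], symmetric]] summand snd
    by simp
qed

text \<open>Transport along Newton's equations, written for functions without symmetry so that it
  applies to a test function before symmetrization.\<close>

definition liouville_op :: "(real^'d \<Rightarrow> real) \<Rightarrow> (('d::finite, 'n::finite) config \<Rightarrow> real) \<Rightarrow> ('d, 'n) config \<Rightarrow> real" where
  "liouville_op W f z =
     (\<Sum>i\<in>UNIV. \<Sum>k\<in>UNIV. snd (z $ i) $ k * frechet_derivative f (at z) (basis_x i k))
     - 2 / real CARD('n) * (\<Sum>i\<in>UNIV. \<Sum>j\<in>UNIV. \<Sum>k\<in>UNIV.
         grad W (fst (z $ i) - fst (z $ j)) $ k * frechet_derivative f (at z) (basis_v i k))"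

text \<open>The factor \<open>CARD('n)\<close> of the bracket cancels the prefactor of
  \<open>H_New\<close>, and the constant \<open>W 0\<close> is differentiated away.\<close>

lemma apply_lie_bracket_H_New:
  fixes f :: "('d::finite, 'n::finite) symfun"
  assumes "smooth W" "\<And>x. W (- x) = W x"
  shows "apply_symfun (lie_bracket f (H_New W)) = liouville_op W (apply_symfun f)"
proof
  fix z :: "('d, 'n) config"
  let ?N = "real CARD('n)"
  let ?f = "\<lambda>e. frechet_derivative (apply_symfun f) (at z) e"
  let ?w = "\<lambda>i j k. grad W (fst (z $ i) - fst (z $ j)) $ k"
  have H: "frechet_derivative (apply_symfun (H_New W)) (at z) e =
      1 / ?N * frechet_derivative (H_N W) (at z) e" for e :: "('d, 'n) config"
  proof -
    have "((\<lambda>z :: ('d, 'n) config. 1 / ?N * (H_N W z + W 0)) has_derivative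
        (\<lambda>e. 1 / ?N * (frechet_derivative (H_N W) (at z) e + 0))) (at z)"
      by (intro has_derivative_mult_right has_derivative_add has_derivative_const
          smooth_has_derivative smooth_H_N assms)
    from frechet_derivative_at[OF this] show ?thesis
      unfolding apply_H_New[OF assms(1)] by (simp add: fun_eq_iff)
  qed
  have "apply_symfun (lie_bracket f (H_New W)) z = ?N * (\<Sum>i\<in>UNIV. \<Sum>k\<in>UNIV.
      1 / ?N * (snd (z $ i) $ k * ?f (basis_x i k))
      - 1 / ?N * (2 / ?N * (\<Sum>j\<in>UNIV. ?w i j k * ?f (basis_v i k))))"
    unfolding apply_lie_bracket H frechet_derivative_H_N_v[OF assms(1)] frechet_derivative_H_N_x[OF assms]
    by (simp add: sum_distrib_left sum_distrib_right mult_ac)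
  also have "\<dots> = (\<Sum>i\<in>UNIV. \<Sum>k\<in>UNIV. snd (z $ i) $ k * ?f (basis_x i k)
      - 2 / ?N * (\<Sum>j\<in>UNIV. ?w i j k * ?f (basis_v i k)))"
    unfolding sum_distrib_left[of ?N] by (intro sum.cong refl) (simp add: right_diff_distrib)
  also have "\<dots> = (\<Sum>i\<in>UNIV. \<Sum>k\<in>UNIV. snd (z $ i) $ k * ?f (basis_x i k))
      - 2 / ?N * (\<Sum>i\<in>UNIV. \<Sum>k\<in>UNIV. \<Sum>j\<in>UNIV. ?w i j k * ?f (basis_v i k))"
    by (simp only: sum_subtractf sum_distrib_left)
  also have "(\<Sum>i\<in>UNIV. \<Sum>k\<in>UNIV. \<Sum>j\<in>UNIV. ?w i j k * ?f (basis_v i k)) =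
      (\<Sum>i\<in>UNIV. \<Sum>j\<in>UNIV. \<Sum>k\<in>UNIV. ?w i j k * ?f (basis_v i k))"
    by (intro sum.cong refl sum.swap)
  finally show "apply_symfun (lie_bracket f (H_New W)) z = liouville_op W (apply_symfun f) z"
    by (simp add: liouville_op_def)
qed

lemma permute_basis:
  assumes "bij p"
  shows "permute p (basis_x (p i) k) = basis_x i k" "permute p (basis_v (p i) k) = basis_v i k"
  unfolding basis_x_def basis_v_def by (rule permute_axis[OF assms])+

text \<open>Relabelling particles permutes coefficients and derivatives simultaneously; the force
  sum runs over two particle indices, and both are reindexed.\<close>

lemma liouville_op_permute:
  fixes f :: "('d::finite, 'n::finite) config \<Rightarrow> real"
  assumes f: "smooth f" and p: "bij p"
  shows "liouville_op W (\<lambda>z. f (permute p z)) z = liouville_op W f (permute p z)"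
proof -
  have reindex: "(\<Sum>i\<in>UNIV. h i) = (\<Sum>i\<in>UNIV. h (p i))" for h :: "'n \<Rightarrow> real"
    using sum.reindex_bij_betw[OF p, of h] by simp
  let ?w = "\<lambda>i j k. grad W (fst (z $ i) - fst (z $ j)) $ k"
  have d: "frechet_derivative (\<lambda>z. f (permute p z)) (at z) e = frechet_derivative f (at (permute p z)) (permute p e)" for e
    by (rule frechet_derivative_compose_bounded_linear[OF f bounded_linear_permute])
  have 1: "(\<Sum>i\<in>UNIV. \<Sum>k\<in>UNIV. snd (z $ i) $ k * frechet_derivative f (at (permute p z)) (permute p (basis_x i k))) =
      (\<Sum>i\<in>UNIV. \<Sum>k\<in>UNIV. snd (permute p z $ i) $ k * frechet_derivative f (at (permute p z)) (basis_x i k))"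
    by (subst reindex) (simp add: permute_basis[OF p], simp add: permute_def)
  have 2: "(\<Sum>i\<in>UNIV. \<Sum>j\<in>UNIV. \<Sum>k\<in>UNIV. ?w i j k * frechet_derivative f (at (permute p z)) (permute p (basis_v i k))) =
      (\<Sum>i\<in>UNIV. \<Sum>j\<in>UNIV. \<Sum>k\<in>UNIV. ?w (p i) (p j) k * frechet_derivative f (at (permute p z)) (basis_v i k))"
    by (subst reindex, rule sum.cong[OF refl], subst reindex) (simp add: permute_basis[OF p])
  show ?thesis unfolding liouville_op_def d 1 2 by (simp add: permute_def)
qed

lemma smooth_snd_nth: "smooth (\<lambda>z :: ('d::finite, 'n::finite) config. snd (z $ i) $ k)"
  and smooth_grad_diff: "smooth W \<Longrightarrow> smooth (\<lambda>z :: ('d, 'n) config. grad W (fst (z $ i) - fst (z $ j)) $ k)"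
proof -
  have "bounded_linear (\<lambda>z :: ('d, 'n) config. snd (z $ i) $ k)"
    using bounded_linear_compose[OF bounded_linear_vec_nth
        bounded_linear_compose[OF bounded_linear_snd bounded_linear_vec_nth]] by auto
  then show "smooth (\<lambda>z :: ('d, 'n) config. snd (z $ i) $ k)" by (rule smooth_linear)
  have "bounded_linear (\<lambda>z :: ('d, 'n) config. fst (z $ i) - fst (z $ j))"
    by (intro bounded_linear_sub bounded_linear_fst_comp bounded_linear_vec_nth)
  then show "smooth W \<Longrightarrow> smooth (\<lambda>z :: ('d, 'n) config. grad W (fst (z $ i) - fst (z $ j)) $ k)"
    unfolding grad_def vec_lambda_beta by (intro smooth_compose_linear[OF smooth_frechet])
qed

lemma smooth_liouville_op: "smooth W \<Longrightarrow> smooth f \<Longrightarrow> smooth (liouville_op W f)"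
  unfolding liouville_op_def[abs_def]
  by (intro smooth_diff smooth_cmult smooth_sum smooth_mult smooth_frechet smooth_snd_nth smooth_grad_diff)

lemma liouville_op_sum:
  assumes "\<And>i. i \<in> A \<Longrightarrow> smooth (f i)"
  shows "liouville_op W (\<lambda>z. \<Sum>i\<in>A. f i z) z = (\<Sum>i\<in>A. liouville_op W (f i) z)"
  using assms
proof (induction A rule: infinite_finite_induct)
  case (insert a A)
  then show ?case
    by (simp add: liouville_op_def frechet_derivative_smooth_add smooth_sum distrib_left sum.distrib right_diff_distrib)
qed (simp_all add: liouville_op_def)

lemma liouville_op_cmult: "smooth f \<Longrightarrow> liouville_op W (\<lambda>z. c * f z) z = c * liouville_op W f z"
  by (simp add: liouville_op_def frechet_derivative_smooth_cmult sum_distrib_left right_diff_distrib mult_ac)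

text \<open>Bridges two settings: the bracket exists on symmetric functions only, while the equation
  is tested with arbitrary ones.\<close>

lemma symmetrize_liouville_op:
  fixes f :: "('d::finite, 'n::finite) config \<Rightarrow> real"
  assumes W: "smooth W" "\<And>x. W (- x) = W x" and f: "smooth f"
  shows "symmetrize (liouville_op W f) = lie_bracket (symmetrize f) (H_New W)"
proof -
  have sm: "smooth (\<lambda>z. f (permute p z))" for p
    by (rule smooth_compose_linear[OF f bounded_linear_permute])
  have "apply_symfun (lie_bracket (symmetrize f) (H_New W)) z = apply_symfun (symmetrize (liouville_op W f)) z" for z
    unfolding apply_lie_bracket_H_New[OF W] apply_symmetrize[OF f] apply_symmetrize[OF smooth_liouville_op[OF W(1) f]]
    by (simp add: liouville_op_cmult liouville_op_sum smooth_sum sm liouville_op_permute[OF f]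
        del: times_divide_eq_left)
  then show ?thesis by (rule symfun_eqI[symmetric])
qed

text \<open>Symmetric test functions are thus among the symmetrized ones, which lets
  \<open>strong_dual_eqI_test_function\<close> conclude from the tested equation.\<close>

lemma symmetrize_symfun: "symmetrize (apply_symfun f) = f"
  for f :: "('d::finite, 'n::finite) symfun"
proof -
  have "card {p :: 'n \<Rightarrow> 'n. bij p} = fact CARD('n)"
    using card_permutations[of "UNIV :: 'n set" "CARD('n)"] by (simp add: permutes_univ bij_iff)
  moreover have "(\<Sum>p\<in>{p. bij p}. apply_symfun f (permute p z)) = (\<Sum>p\<in>{p :: 'n \<Rightarrow> 'n. bij p}. apply_symfun f z)" for z
    using symmetric_symfun[of f] by (intro sum.cong) (auto simp: symmetric_def)
  ultimately have "apply_symfun (symmetrize (apply_symfun f)) z = apply_symfun f z" for z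
    unfolding apply_symmetrize[OF smooth_symfun] by simp
  then show ?thesis by (rule symfun_eqI)
qed

section \<open>Linearity of symmetrization\<close>

lemma symmetrize_diff:
  "smooth f \<Longrightarrow> smooth g \<Longrightarrow> symmetrize (\<lambda>z. f z - g z) = symmetrize f - symmetrize g"
  by (auto intro!: symfun_eqI simp: minus_symfun.rep_eq
      apply_symmetrize smooth_diff sum_subtractf right_diff_distrib diff_divide_distrib)

lemma symmetrize_cmult: "smooth f \<Longrightarrow> symmetrize (\<lambda>z. c * f z) = c *\<^sub>R symmetrize f"
  by (auto intro!: symfun_eqI simp: scaleR_symfun.rep_eq
      apply_symmetrize smooth_cmult simp flip: sum_distrib_left)

lemma symmetrize_sum:
  fixes f :: "'a \<Rightarrow> ('b::finite, 'c::finite) config \<Rightarrow> real"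
  assumes "\<And>i. i \<in> A \<Longrightarrow> smooth (f i)"
  shows "symmetrize (\<lambda>z. \<Sum>i\<in>A. f i z) = (\<Sum>i\<in>A. symmetrize (f i))"
proof -
  have sum: "apply_symfun (\<Sum>i\<in>A. s i) z = (\<Sum>i\<in>A. apply_symfun (s i) z)"
    for s :: "'a \<Rightarrow> ('b, 'c) symfun" and A z
    by (induction A rule: infinite_finite_induct) (simp_all add: zero_symfun.rep_eq plus_symfun.rep_eq)
  have "apply_symfun (symmetrize (\<lambda>z. \<Sum>i\<in>A. f i z)) z = apply_symfun (\<Sum>i\<in>A. symmetrize (f i)) z" for z
  proof -
    have "apply_symfun (symmetrize (\<lambda>z. \<Sum>i\<in>A. f i z)) z =
        (1 / fact CARD('c)) * (\<Sum>p\<in>{p. bij p}. \<Sum>i\<in>A. f i (permute p z))"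
      by (simp add: apply_symmetrize smooth_sum assms)
    also have "\<dots> = (\<Sum>i\<in>A. (1 / fact CARD('c)) * (\<Sum>p\<in>{p. bij p}. f i (permute p z)))"
      unfolding sum_distrib_left by (rule sum.swap)
    also have "\<dots> = apply_symfun (\<Sum>i\<in>A. symmetrize (f i)) z"
      unfolding sum by (intro sum.cong refl) (simp add: apply_symmetrize assms)
    finally show ?thesis .
  qed
  then show ?thesis by (rule symfun_eqI)
qed

text \<open>The product rule produces a second term with the derivative of \<open>a\<close>, zero
  because \<open>a\<close> is constant along \<open>e\<close>. It is used with velocities along
  position directions and forces along velocity directions.\<close>

lemma dist_mult_dist_partial:
  assumes "smooth a" "smooth \<phi>" "\<And>z. frechet_derivative a (at z) e = 0"
  shows "dist_mult a (dist_partial e T) \<phi> = - T (\<lambda>z. a z * frechet_derivative \<phi> (at z) e)"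
  unfolding dist_mult_def dist_partial_def using assms by (simp add: frechet_derivative_smooth_mult)

lemma frechet_derivative_snd_nth_basis_x:
  "frechet_derivative (\<lambda>z :: ('d::finite, 'n::finite) config. snd (z $ i) $ k) (at z) (basis_x j l) = 0"
proof -
  have "bounded_linear (\<lambda>z :: ('d, 'n) config. snd (z $ i) $ k)"
    using bounded_linear_compose[OF bounded_linear_vec_nth
        bounded_linear_compose[OF bounded_linear_snd bounded_linear_vec_nth]] by auto
  from fun_cong[OF frechet_derivative_at[OF bounded_linear_imp_has_derivative[OF this], symmetric]]
  have "frechet_derivative (\<lambda>z :: ('d, 'n) config. snd (z $ i) $ k) (at z) (basis_x j l) =
      snd (basis_x j l $ i) $ k" .
  also have "\<dots> = 0" by (simp add: basis_x_def axis_def)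
  finally show ?thesis .
qed

lemma frechet_derivative_grad_diff_basis_v:
  assumes "smooth W"
  shows "frechet_derivative (\<lambda>z :: ('d::finite, 'n::finite) config. grad W (fst (z $ i) - fst (z $ j)) $ k)
    (at z) (basis_v m l) = 0"
proof -
  have L: "bounded_linear (\<lambda>z :: ('d, 'n) config. fst (z $ i) - fst (z $ j))"
    by (intro bounded_linear_sub bounded_linear_fst_comp bounded_linear_vec_nth)
  have "fst (basis_v m l $ i) - fst (basis_v m l $ j) = (0 :: real^'d)"
    by (simp add: basis_v_def axis_def)
  then show ?thesis
    using frechet_derivative_compose_bounded_linear[OF smooth_frechet[OF assms] L, of "axis k 1" z "basis_v m l"]
    by (simp add: grad_def linear_0[OF smooth_linear_frechet[OF smooth_frechet[OF assms]]])
qed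

text \<open>Each transport term changes sign once when its derivative moves to the test function; by
  linearity the pieces reassemble to minus the pairing with \<open>liouville_op\<close>.\<close>

lemma liouville_solution_iff:
  fixes \<gamma> :: "real \<Rightarrow> ('d::finite, 'n::finite) symfun strong_dual"
  assumes W: "smooth W" "\<And>x. W (- x) = W x"
  shows "liouville_solution W I \<gamma> \<longleftrightarrow> (\<forall>t\<in>I. \<forall>\<phi>. test_function \<phi> \<longrightarrow>
    pairing (curve_deriv I \<gamma> t) (symmetrize \<phi>) = pairing (lie_poisson_vf (H_New W) (\<gamma> t)) (symmetrize \<phi>))"
proof -
  have "distribution_of (curve_deriv I \<gamma> t) \<phi>
        + (\<Sum>i\<in>UNIV. \<Sum>k\<in>UNIV.
             dist_mult (\<lambda>z. snd (z $ i) $ k) (dist_partial (basis_x i k) (distribution_of (\<gamma> t))) \<phi>)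
        - (2 / real CARD('n)) * (\<Sum>i\<in>UNIV. \<Sum>j\<in>UNIV. \<Sum>k\<in>UNIV.
             dist_mult (\<lambda>z. grad W (fst (z $ i) - fst (z $ j)) $ k)
               (dist_partial (basis_v i k) (distribution_of (\<gamma> t))) \<phi>)
      = pairing (curve_deriv I \<gamma> t) (symmetrize \<phi>) - pairing (lie_poisson_vf (H_New W) (\<gamma> t)) (symmetrize \<phi>)"
    if "smooth \<phi>" for t and \<phi> :: "('d, 'n) config \<Rightarrow> real"
  proof -
    note sm = smooth_mult[OF smooth_snd_nth smooth_frechet[OF that]]
      smooth_mult[OF smooth_grad_diff[OF W(1)] smooth_frechet[OF that]]
    have "pairing (lie_poisson_vf (H_New W) (\<gamma> t)) (symmetrize \<phi>) = pairing (\<gamma> t) (symmetrize (liouville_op W \<phi>))"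
      by (simp add: pairing_lie_poisson_vf symmetrize_liouville_op[OF W that])
    also have "\<dots> = (\<Sum>i\<in>UNIV. \<Sum>k\<in>UNIV.
          pairing (\<gamma> t) (symmetrize (\<lambda>z. snd (z $ i) $ k * frechet_derivative \<phi> (at z) (basis_x i k))))
        - 2 / real CARD('n) * (\<Sum>i\<in>UNIV. \<Sum>j\<in>UNIV. \<Sum>k\<in>UNIV. pairing (\<gamma> t)
            (symmetrize (\<lambda>z. grad W (fst (z $ i) - fst (z $ j)) $ k * frechet_derivative \<phi> (at z) (basis_v i k))))"
      unfolding liouville_op_def[abs_def]
      by (simp add: symmetrize_diff symmetrize_cmult symmetrize_sum smooth_sum smooth_cmult sm linear_sum[OF linear_pairing]
          del: times_divide_eq_left)
    finally show ?thesis
      by (simp add: dist_mult_dist_partial[OF smooth_snd_nth that frechet_derivative_snd_nth_basis_x]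
          dist_mult_dist_partial[OF smooth_grad_diff[OF W(1)] that frechet_derivative_grad_diff_basis_v[OF W(1)]]
          sum_negf distribution_of_def)
  qed
  then show ?thesis unfolding liouville_solution_def test_function_def by auto
qed

theorem proposition2p3:
  fixes W :: "real^'d::finite \<Rightarrow> real"
    and \<gamma> :: "real \<Rightarrow> ('d, 'n::finite) symfun strong_dual"
    and a b :: real
  assumes "smooth W"
    and "\<And>x. W (- x) = W x"
    and "a < b"
    and "gateaux_smooth {a..b} \<gamma>"
  shows "(\<exists>!X. is_hamiltonian_vf (H_Lio W :: ('d, 'n) symfun strong_dual \<Rightarrow> real) X) \<and>
    (liouville_solution W {a..b} \<gamma> \<longleftrightarrow>
      (\<forall>t\<in>{a..b}. curve_deriv {a..b} \<gamma> t = hamiltonian_vf (H_Lio W) (\<gamma> t)))"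
proof -
  have H: "H_Lio W = (\<lambda>\<phi> :: ('d, 'n) symfun strong_dual. pairing \<phi> (H_New W))"
    by (simp add: H_Lio_def fun_eq_iff)
  have ham: "hamiltonian_vf (H_Lio W) = lie_poisson_vf (H_New W :: ('d, 'n) symfun)"
    unfolding hamiltonian_vf_def H is_hamiltonian_vf_pairing_iff by simp
  have "liouville_solution W {a..b} \<gamma> \<longleftrightarrow>
      (\<forall>t\<in>{a..b}. curve_deriv {a..b} \<gamma> t = lie_poisson_vf (H_New W) (\<gamma> t))"
    unfolding liouville_solution_iff[OF assms(1,2)]
  proof (intro ball_cong refl iffI strong_dual_eqI_test_function)
    fix t and f :: "('d, 'n) symfun"
    assume "\<forall>\<phi>. test_function \<phi> \<longrightarrow> pairing (curve_deriv {a..b} \<gamma> t) (symmetrize \<phi>) =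
        pairing (lie_poisson_vf (H_New W) (\<gamma> t)) (symmetrize \<phi>)" and "test_function (apply_symfun f)"
    then show "pairing (curve_deriv {a..b} \<gamma> t) f = pairing (lie_poisson_vf (H_New W) (\<gamma> t)) f"
      by (metis symmetrize_symfun)
  qed simp
  then show ?thesis unfolding ham unfolding H is_hamiltonian_vf_pairing_iff by simp
qed

end
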